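(* Let $V$ be a separable Banach space, let $T>0$, and let $(X(t)\colon t\in[0,T])$ and $(X_n(t)\colon t\in[0,T])$, $n\in\mathbb{N}$, be $V$-valued, stochastically continuous stochastic processes with càdlàg trajectories, all defined on a common probability space $(\Omega,\mathcal{A},P)$. Then the following are equivalent: (a) $X_n\to X$ in probability in $(D([0,T];V),d_M)$ as $n\to\infty$, i.e. $\lim_{n\to\infty}P(d_M(X_n,X)\ge\varepsilon)=0$ for all $\varepsilon>0$. (b) The following two conditions are satisfied: (i) for every $t\in[0,T]$, $\lim_{n\to\infty}X_n(t)=X(t)$ in probability; (ii) for every $\varepsilon>0$, $\displaystyle\lim_{\delta\searrow0}\limsup_{n\to\infty}P\big(M(X_n;\delta)\ge\varepsilon\big)=0$.
   Context: For a separable Banach space $V$ with norm $\|\cdot\|$, $D([0,T];V)$ is the space of càdlàg functions $f\colon[0,T]\to V$. Segment: $[\![v_1,v_2]\!]:=\{\alpha v_1+(1-\alpha)v_2\colon\alpha\in[0,1]\}$ for $v_1,v_2\in V$. Extended graph: $\Gamma(f):=\{(t,v)\in[0,T]\times V\colon v\in[\![f(t-),f(t)]\!]\}$ with $f(0-):=f(0)$, totally ordered by: $(t_1,v_1)\le(t_2,v_2)$ iff $t_1<t_2$, or $t_1=t_2$ and $\|f(t_1-)-v_1\|\le\|f(t_1-)-v_2\|$. A parametric representation of $\Gamma(f)$ is a continuous, non-decreasing (for this order), surjective function $(r,u)\colon[0,1]\to\Gamma(f)$ with $(r,u)(0)=(0,f(0))$ and $(r,u)(1)=(T,f(T))$.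 $\Pi(f)$ is the set of all parametric representations. Strong $M_1$ metric: $d_M(f_1,f_2):=\inf\{|r_1-r_2|_\infty\vee\|u_1-u_2\|_\infty\colon(r_i,u_i)\in\Pi(f_i),\ i=1,2\}$, where $|\cdot|_\infty,\|\cdot\|_\infty$ are supremum norms on $[0,1]$. Oscillation function: for $v_1,v,v_2\in V$ put $M(v_1,v,v_2):=\inf_{\alpha\in[0,1]}\|v-(\alpha v_1+(1-\alpha)v_2)\|$, and for $f\in D([0,T];V)$, $\delta>0$, $M(f;\delta):=\sup\{M(f(t_1),f(t),f(t_2))\colon0\le t_1<t<t_2\le T,\ t_2-t_1\le\delta\}$. Stochastically continuous means continuous in probability at every $t\in[0,T]$. *)

theory Defs
  imports "HOL-Probability.Probability"
begin

text \<open>Elements of \<open>D([0,T];V)\<close> are represented by functions on the whole real line. All notions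
  below depend only on the values on \<open>{0..T}\<close>.\<close>

definition cadlag_on :: "real \<Rightarrow> (real \<Rightarrow> 'v::topological_space) \<Rightarrow> bool" where
  "cadlag_on T f \<longleftrightarrow>
     (\<forall>t\<in>{0..<T}. (f \<longlongrightarrow> f t) (at_right t)) \<and>
     (\<forall>t\<in>{0<..T}. \<exists>l. (f \<longlongrightarrow> l) (at_left t))"

text \<open>The left limit \<open>f(t-)\<close>, with the convention \<open>f(0-) = f(0)\<close>.\<close>

definition left_lim :: "(real \<Rightarrow> 'v::t2_space) \<Rightarrow> real \<Rightarrow> 'v" where
  "left_lim f t = (if t = 0 then f 0 else Lim (at_left t) f)"

definition extended_graph :: "real \<Rightarrow> (real \<Rightarrow> 'v::real_normed_vector) \<Rightarrow> (real \<times> 'v) set" where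
  "extended_graph T f = {(t, v). t \<in> {0..T} \<and> v \<in> closed_segment (left_lim f t) (f t)}"

definition graph_le :: "(real \<Rightarrow> 'v::real_normed_vector) \<Rightarrow> real \<times> 'v \<Rightarrow> real \<times> 'v \<Rightarrow> bool" where
  "graph_le f p q \<longleftrightarrow>
     fst p < fst q \<or>
     fst p = fst q \<and> norm (left_lim f (fst p) - snd p) \<le> norm (left_lim f (fst p) - snd q)"

definition param_reps ::
  "real \<Rightarrow> (real \<Rightarrow> 'v::real_normed_vector) \<Rightarrow> ((real \<Rightarrow> real) \<times> (real \<Rightarrow> 'v)) set" where
  "param_reps T f = {(r, u).
     continuous_on {0..1} (\<lambda>s. (r s, u s)) \<and>
     (\<lambda>s. (r s, u s)) ` {0..1} = extended_graph T f \<and>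
     (\<forall>s\<in>{0..1}. \<forall>s'\<in>{0..1}. s \<le> s' \<longrightarrow> graph_le f (r s, u s) (r s', u s')) \<and>
     (r 0, u 0) = (0, f 0) \<and> (r 1, u 1) = (T, f T)}"

text \<open>The infimum and suprema are taken in \<^typ>\<open>real\<close>. For cadlag functions this is harmless:
  parametric representations exist, and they are bounded by compactness of \<open>{0..1}\<close>.\<close>

definition dist_M1 ::
  "real \<Rightarrow> (real \<Rightarrow> 'v::real_normed_vector) \<Rightarrow> (real \<Rightarrow> 'v) \<Rightarrow> real" where
  "dist_M1 T f g =
     Inf {max (SUP s\<in>{0..1}. \<bar>r1 s - r2 s\<bar>) (SUP s\<in>{0..1}. norm (u1 s - u2 s)) | r1 u1 r2 u2.
            (r1, u1) \<in> param_reps T f \<and> (r2, u2) \<in> param_reps T g}"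

definition seg_dist :: "'v::real_normed_vector \<Rightarrow> 'v \<Rightarrow> 'v \<Rightarrow> real" where
  "seg_dist v1 v v2 = (INF \<alpha>\<in>{0..1}. norm (v - (\<alpha> *\<^sub>R v1 + (1 - \<alpha>) *\<^sub>R v2)))"

text \<open>For cadlag \<open>f\<close> and \<open>T, \<delta> > 0\<close> the supremum is over a nonempty bounded set of reals.\<close>

definition osc_M1 :: "real \<Rightarrow> (real \<Rightarrow> 'v::real_normed_vector) \<Rightarrow> real \<Rightarrow> real" where
  "osc_M1 T f \<delta> =
     Sup {seg_dist (f t1) (f t) (f t2) | t1 t t2.
            0 \<le> t1 \<and> t1 < t \<and> t < t2 \<and> t2 \<le> T \<and> t2 - t1 \<le> \<delta>}"

text \<open>Convergence in probability along a filter, with respect to a distance \<open>d\<close> on the state space.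
  A non-measurable event would get measure \<open>0\<close>. For random variables with values in a separable space
  and \<open>d = dist\<close> the events are measurable. So are those for \<open>d = dist_M1 T\<close> and cadlag processes, since
  \<open>dist_M1 T\<close> is then a pointwise limit of its values on discretised step paths, which depend
  continuously on finitely many coordinates.\<close>

definition converges_in_prob ::
  "'w measure \<Rightarrow> ('s \<Rightarrow> 's \<Rightarrow> real) \<Rightarrow> ('i \<Rightarrow> 'w \<Rightarrow> 's) \<Rightarrow> ('w \<Rightarrow> 's) \<Rightarrow> 'i filter \<Rightarrow> bool" where
  "converges_in_prob M d Y Z F \<longleftrightarrow>
     (\<forall>\<epsilon>>0. ((\<lambda>i. measure M {\<omega> \<in> space M. d (Y i \<omega>) (Z \<omega>) \<ge> \<epsilon>}) \<longlongrightarrow> 0) F)"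

definition stoch_continuous_on ::
  "'w measure \<Rightarrow> real \<Rightarrow> (real \<Rightarrow> 'w \<Rightarrow> 'v::metric_space) \<Rightarrow> bool" where
  "stoch_continuous_on M T X \<longleftrightarrow>
     (\<forall>t\<in>{0..T}. converges_in_prob M dist X (X t) (at t within {0..T}))"

definition stoch_cont_cadlag_process ::
  "'w measure \<Rightarrow> real \<Rightarrow> (real \<Rightarrow> 'w \<Rightarrow> 'v::metric_space) \<Rightarrow> bool" where
  "stoch_cont_cadlag_process M T X \<longleftrightarrow>
     (\<forall>t\<in>{0..T}. X t \<in> borel_measurable M) \<and>
     stoch_continuous_on M T X \<and>
     (\<forall>\<omega>\<in>space M. cadlag_on T (\<lambda>t. X t \<omega>))"

end

theory Submission
  imports Defs
begin

text \<open>
  In the extended graph a jump is a straight segment, and \<open>d\<^sub>M\<close> asks of a nearby path only that it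
  runs along this segment in the right direction. Polygons are therefore good approximants, even of
  functions with jumps. Let \<open>p\<^sub>n f\<close> interpolate \<open>f\<close> linearly at the points \<open>iT/n\<close>. Three
  points of the extended graph that come in order within a time window shorter than \<open>\<delta>\<close> lie almost in
  order on a segment, with an error controlled by \<open>M(f;\<delta>)\<close> (\<open>seg_dist_extended_graph\<close>). Hence the
  part of the curve \<open>u\<close> between two grid points stays close to its chord and hardly turns back, and
  the largest distance from its starting point reached so far is a monotone clock along the chord that
  keeps pace with \<open>u\<close> (\<open>curve_near_segment\<close>). This gives
  \<open>d\<^sub>M(f, p\<^sub>n f) \<le> T/n + 27 M(f;\<delta>)\<close> for \<open>T/n < \<delta>\<close> (\<open>dist_M1_polygon_approx\<close>).

  Two polygons over the same grid are as close as their vertices. By the triangle inequality,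
  \<open>d\<^sub>M(X\<^sub>n, X)\<close> is then bounded by finitely many marginal differences, the mesh and the two
  oscillations (\<open>dist_M1_le_grid\<close>). Since \<open>M(f;\<delta>) \<rightarrow> 0\<close> as \<open>\<delta> \<rightarrow> 0\<close> for each fixed
  cadlag \<open>f\<close> (\<open>osc_M1_tendsto_0\<close>), the oscillation condition on \<open>X\<^sub>n\<close> and convergence of
  the marginals on the grid make this bound small in probability.

  For the converse, suppose that \<open>d\<^sub>M(g, f) < \<eta>\<close>. Points of the graph of \<open>g\<close> are matched, in order, with
  points of the extended graph of \<open>f\<close> at distance less than \<open>\<eta>\<close>. So \<open>M(g;\<delta>)\<close> is at most
  \<open>3\<eta> + 9 M(f;\<delta>')\<close> with a slightly larger \<open>\<delta>'\<close> (\<open>osc_M1_le_if_dist_M1_less\<close>), which gives the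
  oscillation condition. For the marginals, enclose \<open>t\<close> by \<open>t1\<close> and \<open>t2\<close>. The point matched with \<open>(t, g t)\<close> lies between them in time,
  hence close to the segment from \<open>f t1\<close> to \<open>f t2\<close> (\<open>norm_diff_le_if_dist_M1_less\<close>), and stochastic
  continuity puts both \<open>X t1\<close> and \<open>X t2\<close> close to \<open>X t\<close>.

  Three facts about \<open>d\<^sub>M\<close> support this. Parametric representations exist: a time change that rests at
  each jump provides one (\<open>param_reps_nonempty\<close>). The triangle inequality holds because
  two representations of the same graph agree, up to \<open>\<epsilon>\<close>, after a change of time
  (\<open>approx_reparam\<close>). Finally, \<open>d\<^sub>M(X\<^sub>n, X)\<close> is measurable, as the limit of the distances
  of the interpolating polygons, which depend continuously on finitely many coordinates
  (\<open>measurable_dist_M1\<close>).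
\<close>

section \<open>Distance to a segment\<close>

text \<open>
  The infimum is attained by compactness of \<open>[0,1]\<close>, so bounds on \<open>seg_dist\<close>
  can be handled through a witness on the segment.
\<close>

lemma seg_dist_le_iff:
  "seg_dist x v y \<le> m \<longleftrightarrow> (\<exists>p\<in>closed_segment x y. norm (v - p) \<le> m)"
proof -
  let ?F = "\<lambda>\<alpha>::real. norm (v - (\<alpha> *\<^sub>R x + (1 - \<alpha>) *\<^sub>R y))"
  have bdd: "bdd_below (?F ` {0..1})"
    by (rule bdd_belowI2[of _ 0]) simp
  have seg: "p \<in> closed_segment x y \<longleftrightarrow> (\<exists>\<alpha>\<in>{0..1}. p = \<alpha> *\<^sub>R x + (1 - \<alpha>) *\<^sub>R y)" for p
    by (subst closed_segment_commute) (auto simp: closed_segment_def add.commute)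
  have "continuous_on {0..1} ?F"
    by (intro continuous_intros)
  then obtain \<alpha> where \<alpha>: "\<alpha> \<in> {0..1}" "\<forall>\<beta>\<in>{0..1}. ?F \<alpha> \<le> ?F \<beta>"
    using continuous_attains_inf[of "{0..1::real}" ?F] by auto
  then have eq: "seg_dist x v y = ?F \<alpha>"
    unfolding seg_dist_def by (intro cInf_eq_minimum) auto
  have "?F \<alpha> \<le> m \<longleftrightarrow> (\<exists>\<beta>\<in>{0..1}. ?F \<beta> \<le> m)"
    using \<alpha> by (meson order_trans)
  also have "\<dots> \<longleftrightarrow> (\<exists>p\<in>closed_segment x y. norm (v - p) \<le> m)"
    unfolding Bex_def seg by auto
  finally show ?thesis
    unfolding eq .
qed

lemma seg_dist_nonneg [simp]: "0 \<le> seg_dist x v y"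
  unfolding seg_dist_def by (rule cINF_greatest) auto

lemma seg_dist_left [simp]: "seg_dist x x y = 0"
  by (rule antisym) (auto simp: seg_dist_le_iff)

lemma seg_dist_right [simp]: "seg_dist x y y = 0"
  by (rule antisym) (auto simp: seg_dist_le_iff)

lemma seg_dist_commute: "seg_dist x v y = seg_dist y v x"
proof -
  have "seg_dist x v y \<le> m \<longleftrightarrow> seg_dist y v x \<le> m" for m
    by (simp add: seg_dist_le_iff closed_segment_commute[of x y])
  then show ?thesis by (metis order_antisym order_refl)
qed

lemma seg_dist_eq_0: "v \<in> closed_segment x y \<Longrightarrow> seg_dist x v y = 0"
  by (rule antisym) (auto simp: seg_dist_le_iff)

lemma seg_dist_perturb:
  "seg_dist x v y \<le> seg_dist x' v' y' + norm (v - v') + norm (x - x') + norm (y - y')"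
proof -
  obtain p where p: "p \<in> closed_segment x' y'" "norm (v' - p) \<le> seg_dist x' v' y'"
    using seg_dist_le_iff[of x' v' y' "seg_dist x' v' y'"] by auto
  then obtain \<alpha> where \<alpha>: "0 \<le> \<alpha>" "\<alpha> \<le> 1" "p = (1 - \<alpha>) *\<^sub>R x' + \<alpha> *\<^sub>R y'"
    by (auto simp: closed_segment_def)
  define q where "q = (1 - \<alpha>) *\<^sub>R x + \<alpha> *\<^sub>R y"
  have q: "q \<in> closed_segment x y"
    using \<alpha> by (auto simp: closed_segment_def q_def)
  have "p - q = (1 - \<alpha>) *\<^sub>R (x' - x) + \<alpha> *\<^sub>R (y' - y)"
    by (simp add: \<alpha>(3) q_def algebra_simps)
  also have "norm \<dots> \<le> norm ((1 - \<alpha>) *\<^sub>R (x' - x)) + norm (\<alpha> *\<^sub>R (y' - y))"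
    by (rule norm_triangle_ineq)
  also have "\<dots> \<le> norm (x' - x) + norm (y' - y)"
    using \<alpha> by (intro add_mono) (auto intro: mult_left_le_one_le)
  finally have "norm (p - q) \<le> norm (x - x') + norm (y - y')"
    by (simp add: norm_minus_commute)
  moreover have "norm (v - q) \<le> norm (v - v') + norm (v' - p) + norm (p - q)"
    using norm_triangle_ineq[of "v - v'" "v' - p"] norm_triangle_ineq[of "v - p" "p - q"] by simp
  ultimately show ?thesis
    using p(2) q seg_dist_le_iff by force
qed

lemma tendsto_seg_dist [tendsto_intros]:
  assumes "(f \<longlongrightarrow> x) F" "(g \<longlongrightarrow> v) F" "(h \<longlongrightarrow> y) F"
  shows "((\<lambda>s. seg_dist (f s) (g s) (h s)) \<longlongrightarrow> seg_dist x v y) F"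
proof -
  have "((\<lambda>s. norm (g s - v) + norm (f s - x) + norm (h s - y))
          \<longlongrightarrow> norm (v - v) + norm (x - x) + norm (y - y)) F"
    using assms by (intro tendsto_intros)
  then have "((\<lambda>s. norm (g s - v) + norm (f s - x) + norm (h s - y)) \<longlongrightarrow> 0) F"
    by simp
  moreover have "norm (seg_dist (f s) (g s) (h s) - seg_dist x v y)
      \<le> norm (g s - v) + norm (f s - x) + norm (h s - y)" for s
    using seg_dist_perturb[of "f s" "g s" "h s" x v y] seg_dist_perturb[of x v y "f s" "g s" "h s"]
    by (simp add: norm_minus_commute abs_le_iff)
  ultimately have "((\<lambda>s. seg_dist (f s) (g s) (h s) - seg_dist x v y) \<longlongrightarrow> 0) F"
    by - (rule Lim_null_comparison[OF always_eventually], auto)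
  then show ?thesis
    by (rule LIM_zero_cancel)
qed

text \<open>
  The \<open>m\<close>-neighbourhood of a segment is convex. A bound at both ends of a jump therefore
  extends to the whole jump segment.
\<close>

lemma seg_dist_convex:
  assumes "seg_dist x v y \<le> m" "seg_dist x w y \<le> m" "c \<in> closed_segment v w"
  shows "seg_dist x c y \<le> m"
proof -
  obtain p where p: "p \<in> closed_segment x y" "norm (v - p) \<le> m"
    using assms(1) by (auto simp: seg_dist_le_iff)
  obtain q where q: "q \<in> closed_segment x y" "norm (w - q) \<le> m"
    using assms(2) by (auto simp: seg_dist_le_iff)
  obtain \<alpha> where \<alpha>: "0 \<le> \<alpha>" "\<alpha> \<le> 1" "c = (1 - \<alpha>) *\<^sub>R v + \<alpha> *\<^sub>R w"
    using assms(3) by (auto simp: closed_segment_def)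
  define d where "d = (1 - \<alpha>) *\<^sub>R p + \<alpha> *\<^sub>R q"
  have d: "d \<in> closed_segment x y"
    using p(1) q(1) \<alpha> convexD[OF convex_closed_segment, of p x y q "1 - \<alpha>" \<alpha>] by (simp add: d_def)
  have "c - d = (1 - \<alpha>) *\<^sub>R (v - p) + \<alpha> *\<^sub>R (w - q)"
    by (simp add: \<alpha>(3) d_def algebra_simps)
  also have "norm \<dots> \<le> (1 - \<alpha>) * norm (v - p) + \<alpha> * norm (w - q)"
    using \<alpha> by (intro order_trans[OF norm_triangle_ineq]) auto
  also have "\<dots> \<le> m"
    using \<alpha> p(2) q(2) by (intro convex_bound_le) auto
  finally show ?thesis
    using d by (auto simp: seg_dist_le_iff)
qed

text \<open>
  The order on a jump segment is by distance from the left limit \<open>a\<close>. This turns it into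
  betweenness.
\<close>

lemma segment_ordered:
  assumes "v \<in> closed_segment a b" "w \<in> closed_segment a b" "norm (a - v) \<le> norm (a - w)"
  shows "v \<in> closed_segment a w" "w \<in> closed_segment v b"
proof -
  obtain \<alpha> where \<alpha>: "0 \<le> \<alpha>" "\<alpha> \<le> 1" "v = (1 - \<alpha>) *\<^sub>R a + \<alpha> *\<^sub>R b"
    using assms(1) by (auto simp: closed_segment_def)
  obtain \<beta> where \<beta>: "0 \<le> \<beta>" "\<beta> \<le> 1" "w = (1 - \<beta>) *\<^sub>R a + \<beta> *\<^sub>R b"
    using assms(2) by (auto simp: closed_segment_def)
  have v: "a - v = \<alpha> *\<^sub>R (a - b)" and w: "a - w = \<beta> *\<^sub>R (a - b)"
    by (simp_all add: \<alpha> \<beta> algebra_simps)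
  have "v \<in> closed_segment a w \<and> w \<in> closed_segment v b"
  proof (cases "a = b")
    case True
    then show ?thesis using \<alpha> \<beta> by (simp add: algebra_simps)
  next
    case False
    have le: "\<alpha> \<le> \<beta>"
      using assms(3) False \<alpha>(1) \<beta>(1) by (simp add: v w)
    have 1: "v \<in> closed_segment a w"
    proof (cases "\<beta> = 0")
      case True
      then show ?thesis using le \<alpha> by simp
    next
      case nz: False
      have "v = (1 - \<alpha>/\<beta>) *\<^sub>R a + (\<alpha>/\<beta>) *\<^sub>R w"
        using nz by (simp add: \<alpha>(3) \<beta>(3) algebra_simps)
      then show ?thesis
        using \<alpha> \<beta> le nz by (auto simp: closed_segment_def intro!: exI[of _ "\<alpha>/\<beta>"])
    qed
    moreover have "w \<in> closed_segment v b"
    proof (cases "\<alpha> = 1")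
      case True
      then show ?thesis using le \<alpha> \<beta> by simp
    next
      case nz: False
      define \<gamma> where "\<gamma> = (\<beta> - \<alpha>) / (1 - \<alpha>)"
      have g: "0 \<le> \<gamma>" "\<gamma> \<le> 1" "\<gamma> * (1 - \<alpha>) = \<beta> - \<alpha>"
        using nz \<alpha> \<beta> le by (auto simp: \<gamma>_def divide_simps)
      have "1 - \<beta> = (1 - \<gamma>) * (1 - \<alpha>)" "\<beta> = (1 - \<gamma>) * \<alpha> + \<gamma>"
        using g(3) by (simp_all add: algebra_simps)
      then have "w = ((1 - \<gamma>) * (1 - \<alpha>)) *\<^sub>R a + ((1 - \<gamma>) * \<alpha> + \<gamma>) *\<^sub>R b"
        using \<beta>(3) by metis
      also have "\<dots> = (1 - \<gamma>) *\<^sub>R v + \<gamma> *\<^sub>R b"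
        by (simp add: \<alpha>(3) scaleR_add_right scaleR_add_left)
      finally show ?thesis
        using g by (auto simp: closed_segment_def)
    qed
    ultimately show ?thesis ..
  qed
  then show "v \<in> closed_segment a w" "w \<in> closed_segment v b" by auto
qed

text \<open>
  If \<open>a, b, y\<close> and \<open>b, v, y\<close> are almost in order, then so are \<open>c, v,
  y\<close> for each \<open>c\<close> between \<open>a\<close> and \<open>b\<close>. Replace
  \<open>b\<close> by a point \<open>b'\<close> of the segment from \<open>a\<close> to
  \<open>y\<close>, move \<open>c\<close> along to \<open>c'\<close> between \<open>a\<close> and
  \<open>b'\<close>, and use that \<open>a, c', b', y\<close> are in order on one line. Each of the
  two replacements and the bound for \<open>v\<close> costs \<open>m\<close>. With \<open>a =
  f(t-)\<close> and \<open>b = f(t)\<close> this moves an end point of a triple into the interior of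
  a jump segment.
\<close>

lemma seg_dist_extend_left:
  assumes ab: "seg_dist a b y \<le> m" and bv: "seg_dist b v y \<le> m" and c: "c \<in> closed_segment a b"
  shows "seg_dist c v y \<le> 3 * m"
proof -
  obtain b' where b': "b' \<in> closed_segment a y" "norm (b - b') \<le> m"
    using ab by (auto simp: seg_dist_le_iff)
  obtain \<alpha> where \<alpha>: "0 \<le> \<alpha>" "\<alpha> \<le> 1" "c = (1 - \<alpha>) *\<^sub>R a + \<alpha> *\<^sub>R b"
    using c by (auto simp: closed_segment_def)
  define c' where "c' = (1 - \<alpha>) *\<^sub>R a + \<alpha> *\<^sub>R b'"
  have "c - c' = \<alpha> *\<^sub>R (b - b')"
    by (simp add: \<alpha>(3) c'_def algebra_simps)
  then have "norm (c - c') \<le> 1 * norm (b - b')"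
    using \<alpha> by (simp add: mult_left_le_one_le)
  then have cc': "norm (c - c') \<le> m" using b'(2) by simp
  have c'_seg: "c' \<in> closed_segment a b'"
    using \<alpha> by (auto simp: closed_segment_def c'_def)
  then have c'_y: "c' \<in> closed_segment a y"
    using b'(1) by (meson ends_in_segment(1) subset_closed_segment subsetD)
  have "norm (a - c') \<le> norm (a - b')"
    using segment_bound[OF c'_seg] by (simp add: norm_minus_commute)
  then have b'c': "b' \<in> closed_segment c' y"
    using segment_ordered(2)[OF c'_y b'(1)] by blast
  have "seg_dist b' v y \<le> seg_dist b v y + norm (v - v) + norm (b' - b) + norm (y - y)"
    by (rule seg_dist_perturb)
  then have "seg_dist b' v y \<le> 2 * m"
    using bv b'(2) by (simp add: norm_minus_commute)
  then obtain v' where "v' \<in> closed_segment b' y" and v': "norm (v - v') \<le> 2 * m"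
    by (auto simp: seg_dist_le_iff)
  then have "v' \<in> closed_segment c' y"
    using b'c' by (meson ends_in_segment(2) subset_closed_segment subsetD)
  then have "seg_dist c' v y \<le> 2 * m"
    using v' by (auto simp: seg_dist_le_iff)
  then show ?thesis
    using seg_dist_perturb[of c v y c' v y] cc' by simp
qed

lemma seg_dist_extend_right:
  assumes "seg_dist y a b \<le> m" "seg_dist y v a \<le> m" "c \<in> closed_segment a b"
  shows "seg_dist y v c \<le> 3 * m"
  using seg_dist_extend_left[of b a y m v c] assms
  by (simp add: seg_dist_commute closed_segment_commute)

section \<open>Cadlag functions\<close>

lemma cadlag_tendsto_left:
  assumes "cadlag_on T f" "0 < t" "t \<le> T"
  shows "(f \<longlongrightarrow> left_lim f t) (at_left t)"
proof -
  obtain l where l: "(f \<longlongrightarrow> l) (at_left t)"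
    using assms unfolding cadlag_on_def by (meson greaterThanAtMost_iff)
  then have "Lim (at_left t) f = l"
    by (intro tendsto_Lim) auto
  then show ?thesis using l assms(2) by (simp add: left_lim_def)
qed

lemma cadlag_tendsto_right:
  assumes "cadlag_on T f" "0 \<le> t" "t < T"
  shows "(f \<longlongrightarrow> f t) (at_right t)"
  using assms by (auto simp: cadlag_on_def)

lemma left_lim_zero [simp]: "left_lim f 0 = f 0"
  by (simp add: left_lim_def)

lemma continuous_left_lim:
  fixes f :: "real \<Rightarrow> 'v::t2_space"
  assumes "isCont f t"
  shows "left_lim f t = f t"
proof -
  have "(f \<longlongrightarrow> f t) (at_left t)"
    using assms by (auto simp: isCont_def intro: filterlim_mono at_le)
  then show ?thesis
    by (auto simp: left_lim_def intro: tendsto_Lim)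
qed

lemma cadlag_left_nbhd:
  fixes f :: "real \<Rightarrow> 'v::real_normed_vector"
  assumes f: "cadlag_on T f" and a: "0 < a" "a \<le> T" and e: "0 < e"
  obtains d where "0 < d"
    "\<And>t. 0 \<le> t \<Longrightarrow> a - d < t \<Longrightarrow> t < a \<Longrightarrow> norm (f t - left_lim f a) \<le> e"
    "\<And>t. 0 \<le> t \<Longrightarrow> a - d < t \<Longrightarrow> t < a \<Longrightarrow> norm (left_lim f t - left_lim f a) \<le> e"
proof -
  have "\<forall>\<^sub>F t in at_left a. dist (f t) (left_lim f a) < e"
    using tendstoD[OF cadlag_tendsto_left[OF f a] e] .
  then obtain b where b: "b < a" "\<And>t. b < t \<Longrightarrow> t < a \<Longrightarrow> dist (f t) (left_lim f a) < e"
    using a by (auto simp: eventually_at_left[of "a - 1" a])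
  have 1: "norm (f t - left_lim f a) \<le> e" if "a - (a - b) < t" "t < a" for t
    using b(2)[of t] that by (simp add: dist_norm)
  have 2: "norm (left_lim f t - left_lim f a) \<le> e" if "0 \<le> t" "a - (a - b) < t" "t < a" for t
  proof (cases "t = 0")
    case True
    then show ?thesis using 1 that by simp
  next
    case False
    have "((\<lambda>s. norm (f s - left_lim f a)) \<longlongrightarrow> norm (left_lim f t - left_lim f a)) (at_left t)"
      using False that a by (intro tendsto_intros cadlag_tendsto_left[OF f]) auto
    moreover have "\<forall>\<^sub>F s in at_left t. norm (f s - left_lim f a) \<le> e"
      using that by (auto simp: eventually_at_left[of b t] intro!: exI[of _ b] 1)
    ultimately show ?thesis
      by (rule tendsto_upperbound) auto
  qed
  show ?thesis
    using b(1) 1 2 by (intro that[of "a - b"]) auto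
qed

lemma cadlag_right_nbhd:
  fixes f :: "real \<Rightarrow> 'v::real_normed_vector"
  assumes f: "cadlag_on T f" and a: "0 \<le> a" "a < T" and e: "0 < e"
  obtains d where "0 < d"
    "\<And>t. t \<le> T \<Longrightarrow> a < t \<Longrightarrow> t < a + d \<Longrightarrow> norm (f t - f a) \<le> e"
    "\<And>t. t \<le> T \<Longrightarrow> a < t \<Longrightarrow> t < a + d \<Longrightarrow> norm (left_lim f t - f a) \<le> e"
proof -
  have "\<forall>\<^sub>F t in at_right a. dist (f t) (f a) < e"
    using tendstoD[OF cadlag_tendsto_right[OF f a] e] .
  then obtain b where b: "a < b" "\<And>t. a < t \<Longrightarrow> t < b \<Longrightarrow> dist (f t) (f a) < e"
    using a by (auto simp: eventually_at_right[of a "a + 1"])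
  have 1: "norm (f t - f a) \<le> e" if "a < t" "t < a + (b - a)" for t
    using b(2)[of t] that by (simp add: dist_norm)
  have 2: "norm (left_lim f t - f a) \<le> e" if "t \<le> T" "a < t" "t < a + (b - a)" for t
  proof -
    have "((\<lambda>s. norm (f s - f a)) \<longlongrightarrow> norm (left_lim f t - f a)) (at_left t)"
      using that a by (intro tendsto_intros cadlag_tendsto_left[OF f]) auto
    moreover have "\<forall>\<^sub>F s in at_left t. norm (f s - f a) \<le> e"
      using that by (auto simp: eventually_at_left[of a t] intro!: exI[of _ a] 1)
    ultimately show ?thesis
      by (rule tendsto_upperbound) auto
  qed
  show ?thesis
    using b(1) 1 2 by (intro that[of "b - a"]) auto
qed

text \<open>
  Near \<open>a\<close>, on either side, not only \<open>f\<close> but also its left limits are close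
  to the corresponding one-sided limit at \<open>a\<close>.
\<close>

lemma cadlag_nbhd:
  fixes f :: "real \<Rightarrow> 'v::real_normed_vector"
  assumes f: "cadlag_on T f" and a: "0 \<le> a" "a \<le> T" and e: "0 < e"
  shows "\<exists>d>0. (\<forall>t. 0 \<le> t \<and> a - d < t \<and> t < a \<longrightarrow>
                  norm (f t - left_lim f a) \<le> e \<and> norm (left_lim f t - left_lim f a) \<le> e)
            \<and> (\<forall>t. t \<le> T \<and> a < t \<and> t < a + d \<longrightarrow>
                  norm (f t - f a) \<le> e \<and> norm (left_lim f t - f a) \<le> e)"
proof -
  have "\<exists>d>0. \<forall>t. 0 \<le> t \<and> a - d < t \<and> t < a \<longrightarrow>
                  norm (f t - left_lim f a) \<le> e \<and> norm (left_lim f t - left_lim f a) \<le> e"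
  proof (cases "a = 0")
    case True
    then show ?thesis by (intro exI[of _ 1]) auto
  next
    case False
    then show ?thesis using cadlag_left_nbhd[OF f _ a(2) e] a(1) by (metis order_le_less)
  qed
  moreover have "\<exists>d>0. \<forall>t. t \<le> T \<and> a < t \<and> t < a + d \<longrightarrow>
                  norm (f t - f a) \<le> e \<and> norm (left_lim f t - f a) \<le> e"
  proof (cases "a = T")
    case True
    then show ?thesis by (intro exI[of _ 1]) auto
  next
    case False
    then show ?thesis using cadlag_right_nbhd[OF f a(1) _ e] a(2) by (metis order_le_less)
  qed
  ultimately obtain d d' where "d > 0" "d' > 0"
    and "\<forall>t. 0 \<le> t \<and> a - d < t \<and> t < a \<longrightarrow>
          norm (f t - left_lim f a) \<le> e \<and> norm (left_lim f t - left_lim f a) \<le> e"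
    and "\<forall>t. t \<le> T \<and> a < t \<and> t < a + d' \<longrightarrow>
          norm (f t - f a) \<le> e \<and> norm (left_lim f t - f a) \<le> e"
    by blast
  then show ?thesis
    by (intro exI[of _ "min d d'"]) auto
qed

lemma cadlag_cover:
  fixes f :: "real \<Rightarrow> 'v::real_normed_vector"
  assumes f: "cadlag_on T f" and e: "0 < e" and T: "0 \<le> T"
  obtains d where
    "\<And>a. a \<in> {0..T} \<Longrightarrow> 0 < d a"
    "\<And>a t. a \<in> {0..T} \<Longrightarrow> 0 \<le> t \<Longrightarrow> a - d a < t \<Longrightarrow> t < a \<Longrightarrow>
       norm (f t - left_lim f a) \<le> e \<and> norm (left_lim f t - left_lim f a) \<le> e"
    "\<And>a t. a \<in> {0..T} \<Longrightarrow> t \<le> T \<Longrightarrow> a < t \<Longrightarrow> t < a + d a \<Longrightarrow>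
       norm (f t - f a) \<le> e \<and> norm (left_lim f t - f a) \<le> e"
proof -
  have "\<forall>a\<in>{0..T}. \<exists>d>0. (\<forall>t. 0 \<le> t \<and> a - d < t \<and> t < a \<longrightarrow>
                  norm (f t - left_lim f a) \<le> e \<and> norm (left_lim f t - left_lim f a) \<le> e)
            \<and> (\<forall>t. t \<le> T \<and> a < t \<and> t < a + d \<longrightarrow>
                  norm (f t - f a) \<le> e \<and> norm (left_lim f t - f a) \<le> e)"
    using cadlag_nbhd[OF f _ _ e] by auto
  then obtain d where "\<forall>a\<in>{0..T}. 0 < d a \<and> (\<forall>t. 0 \<le> t \<and> a - d a < t \<and> t < a \<longrightarrow>
                  norm (f t - left_lim f a) \<le> e \<and> norm (left_lim f t - left_lim f a) \<le> e)
            \<and> (\<forall>t. t \<le> T \<and> a < t \<and> t < a + d a \<longrightarrow>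
                  norm (f t - f a) \<le> e \<and> norm (left_lim f t - f a) \<le> e)"
    by (auto simp: bchoice_iff)
  then show ?thesis by (intro that[of d]) auto
qed

lemma finite_subcover_balls:
  fixes d :: "real \<Rightarrow> real"
  assumes "\<And>a. a \<in> {0..T} \<Longrightarrow> 0 < d a"
  obtains C where "finite C" "C \<subseteq> {0..T}" "{0..T} \<subseteq> (\<Union>c\<in>C. ball c (d c))"
proof -
  have "{0..T} \<subseteq> (\<Union>c\<in>{0..T}. ball c (d c))"
    using assms by force
  then obtain C where "C \<subseteq> {0..T}" "finite C" "{0..T} \<subseteq> (\<Union>c\<in>C. ball c (d c))"
    using compactE_image[of "{0..T}" "{0..T}" "\<lambda>c. ball c (d c)"] by auto
  then show ?thesis using that by blast
qed

lemma cadlag_bounded: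
  fixes f :: "real \<Rightarrow> 'v::real_normed_vector"
  assumes f: "cadlag_on T f" and T: "0 \<le> T"
  obtains B where "\<And>t. t \<in> {0..T} \<Longrightarrow> norm (f t) \<le> B"
proof -
  obtain d where d: "\<And>a. a \<in> {0..T} \<Longrightarrow> 0 < d a"
    and dl: "\<And>a t. a \<in> {0..T} \<Longrightarrow> 0 \<le> t \<Longrightarrow> a - d a < t \<Longrightarrow> t < a \<Longrightarrow>
       norm (f t - left_lim f a) \<le> 1 \<and> norm (left_lim f t - left_lim f a) \<le> 1"
    and dr: "\<And>a t. a \<in> {0..T} \<Longrightarrow> t \<le> T \<Longrightarrow> a < t \<Longrightarrow> t < a + d a \<Longrightarrow>
       norm (f t - f a) \<le> 1 \<and> norm (left_lim f t - f a) \<le> 1"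
    using cadlag_cover[OF f zero_less_one T] by blast
  obtain C where C: "finite C" "C \<subseteq> {0..T}" "{0..T} \<subseteq> (\<Union>c\<in>C. ball c (d c))"
    using finite_subcover_balls[of T d] d by blast
  have "norm (f t) \<le> 1 + (\<Sum>c\<in>C. norm (f c) + norm (left_lim f c))" if t: "t \<in> {0..T}" for t
  proof -
    obtain c where c: "c \<in> C" "t \<in> ball c (d c)" using C t by blast
    have "norm (f t) \<le> 1 + (norm (f c) + norm (left_lim f c))"
    proof (cases t c rule: linorder_cases)
      case less
      then have "norm (f t - left_lim f c) \<le> 1"
        using dl[of c t] c C t by (auto simp: dist_real_def)
      then show ?thesis
        using norm_triangle_sub[of "f t" "left_lim f c"] norm_ge_zero[of "f c"] by linarith
    next
      case greater
      then have "norm (f t - f c) \<le> 1"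
        using dr[of c t] c C t by (auto simp: dist_real_def)
      then show ?thesis
        using norm_triangle_sub[of "f t" "f c"] norm_ge_zero[of "left_lim f c"] by linarith
    qed auto
    also have "\<dots> \<le> 1 + (\<Sum>c\<in>C. norm (f c) + norm (left_lim f c))"
      using c(1) C(1) by (intro add_left_mono member_le_sum) auto
    finally show ?thesis .
  qed
  then show ?thesis by (rule that)
qed

text \<open>
  Jumps larger than \<open>2e\<close> can only sit at the centres of a finite cover of
  \<open>[0,T]\<close> by intervals on whose two halves \<open>f\<close> varies by at most
  \<open>e\<close> around its one-sided limit.
\<close>

lemma cadlag_countable_jumps:
  fixes f :: "real \<Rightarrow> 'v::real_normed_vector"
  assumes f: "cadlag_on T f" and T: "0 \<le> T"
  shows "countable {t \<in> {0..T}. left_lim f t \<noteq> f t}"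
proof -
  have fin: "finite {t \<in> {0..T}. norm (f t - left_lim f t) > 2 * e}" if e: "e > 0" for e
  proof -
    obtain d where d: "\<And>a. a \<in> {0..T} \<Longrightarrow> 0 < d a"
      and dl: "\<And>a t. a \<in> {0..T} \<Longrightarrow> 0 \<le> t \<Longrightarrow> a - d a < t \<Longrightarrow> t < a \<Longrightarrow>
         norm (f t - left_lim f a) \<le> e \<and> norm (left_lim f t - left_lim f a) \<le> e"
      and dr: "\<And>a t. a \<in> {0..T} \<Longrightarrow> t \<le> T \<Longrightarrow> a < t \<Longrightarrow> t < a + d a \<Longrightarrow>
         norm (f t - f a) \<le> e \<and> norm (left_lim f t - f a) \<le> e"
      using cadlag_cover[OF f e T] by blast
    obtain C where C: "finite C" "C \<subseteq> {0..T}" "{0..T} \<subseteq> (\<Union>c\<in>C. ball c (d c))"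
      using finite_subcover_balls[of T d] d by blast
    have "t \<in> C" if t: "t \<in> {0..T}" "norm (f t - left_lim f t) > 2 * e" for t
    proof -
      obtain c where c: "c \<in> C" "t \<in> ball c (d c)" using C t by blast
      have close: "norm (f t - left_lim f t) \<le> 2 * e"
        if "norm (f t - z) \<le> e \<and> norm (left_lim f t - z) \<le> e" for z
        using norm_triangle_ineq4[of "f t - z" "left_lim f t - z"] that by simp
      show ?thesis
      proof (cases t c rule: linorder_cases)
        case less
        then have "norm (f t - left_lim f t) \<le> 2 * e"
          using dl[of c t] c C t by (intro close) (auto simp: dist_real_def)
        then show ?thesis using t by simp
      next
        case greater
        then have "norm (f t - left_lim f t) \<le> 2 * e"
          using dr[of c t] c C t by (intro close) (auto simp: dist_real_def)
        then show ?thesis using t by simp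
      qed (use c in auto)
    qed
    then show ?thesis by (intro finite_subset[OF _ C(1)] subsetI) auto
  qed
  have "{t \<in> {0..T}. left_lim f t \<noteq> f t}
      \<subseteq> (\<Union>n. {t \<in> {0..T}. norm (f t - left_lim f t) > 2 * inverse (real (Suc n))})"
  proof safe
    fix t assume t: "t \<in> {0..T}" "left_lim f t \<noteq> f t"
    then have "norm (f t - left_lim f t) / 2 > 0" by simp
    then obtain n where "inverse (real (Suc n)) < norm (f t - left_lim f t) / 2"
      using reals_Archimedean by blast
    then show "t \<in> (\<Union>n. {t \<in> {0..T}. norm (f t - left_lim f t) > 2 * inverse (real (Suc n))})"
      using t by (intro UN_I[of n]) auto
  qed
  moreover have "countable (\<Union>n. {t \<in> {0..T}. norm (f t - left_lim f t) > 2 * inverse (real (Suc n))})"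
    by (rule countable_UN[OF countableI_type], rule countable_finite, rule fin) simp
  ultimately show ?thesis by (rule countable_subset)
qed

section \<open>The oscillation of a cadlag function\<close>

definition osc_triples :: "real \<Rightarrow> real \<Rightarrow> (real \<times> real \<times> real) set" where
  "osc_triples T \<delta> =
     {(t1, t, t2). 0 \<le> t1 \<and> t1 < t \<and> t < t2 \<and> t2 \<le> T \<and> t2 - t1 \<le> \<delta>}"

lemma osc_M1_altdef: "osc_M1 T f \<delta> = (SUP (t1, t, t2)\<in>osc_triples T \<delta>. seg_dist (f t1) (f t) (f t2))"
  unfolding osc_M1_def osc_triples_def by (rule arg_cong[of _ _ Sup]) (auto simp: image_def)

lemma osc_triples_nonempty:
  assumes "0 < T" "0 < \<delta>"
  shows "osc_triples T \<delta> \<noteq> {}"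
proof -
  have "(0, min T \<delta> / 2, min T \<delta>) \<in> osc_triples T \<delta>"
    using assms by (auto simp: osc_triples_def)
  then show ?thesis by blast
qed

lemma osc_M1_bdd:
  fixes f :: "real \<Rightarrow> 'v::real_normed_vector"
  assumes "cadlag_on T f" "0 \<le> T"
  shows "bdd_above ((\<lambda>(t1, t, t2). seg_dist (f t1) (f t) (f t2)) ` osc_triples T \<delta>)"
proof -
  obtain B where B: "\<And>t. t \<in> {0..T} \<Longrightarrow> norm (f t) \<le> B"
    using cadlag_bounded[OF assms] by blast
  have "seg_dist (f t1) (f t) (f t2) \<le> 2 * B" if "(t1, t, t2) \<in> osc_triples T \<delta>" for t1 t t2
  proof -
    have "norm (f t - f t1) \<le> 2 * B"
      using B[of t] B[of t1] that norm_triangle_ineq4[of "f t" "f t1"] by (auto simp: osc_triples_def)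
    then show ?thesis
      by (auto simp: seg_dist_le_iff intro!: bexI[of _ "f t1"])
  qed
  then show ?thesis
    by (intro bdd_aboveI2[of _ _ "2 * B"]) auto
qed

lemma seg_dist_le_osc:
  fixes f :: "real \<Rightarrow> 'v::real_normed_vector"
  assumes "cadlag_on T f" "0 \<le> t1" "t1 < t" "t < t2" "t2 \<le> T" "t2 - t1 \<le> \<delta>"
  shows "seg_dist (f t1) (f t) (f t2) \<le> osc_M1 T f \<delta>"
proof -
  have "(t1, t, t2) \<in> osc_triples T \<delta>"
    using assms by (auto simp: osc_triples_def)
  then show ?thesis
    unfolding osc_M1_altdef using osc_M1_bdd[OF assms(1)] assms
    by (intro cSUP_upper2[of _ _ "(t1, t, t2)"]) auto
qed

lemma osc_M1_leI:
  assumes "0 < T" "0 < \<delta>"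
    and "\<And>t1 t t2. 0 \<le> t1 \<Longrightarrow> t1 < t \<Longrightarrow> t < t2 \<Longrightarrow> t2 \<le> T \<Longrightarrow> t2 - t1 \<le> \<delta> \<Longrightarrow>
           seg_dist (f t1) (f t) (f t2) \<le> m"
  shows "osc_M1 T f \<delta> \<le> m"
  unfolding osc_M1_altdef using assms osc_triples_nonempty[OF assms(1,2)]
  by (intro cSUP_least) (auto simp: osc_triples_def)

lemma osc_M1_nonneg:
  fixes f :: "real \<Rightarrow> 'v::real_normed_vector"
  assumes "cadlag_on T f" "0 < T" "0 < \<delta>"
  shows "0 \<le> osc_M1 T f \<delta>"
proof -
  have "0 \<le> seg_dist (f 0) (f (min T \<delta> / 2)) (f (min T \<delta>))" by simp
  also have "\<dots> \<le> osc_M1 T f \<delta>"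
    using assms by (intro seg_dist_le_osc) auto
  finally show ?thesis .
qed

lemma osc_M1_mono:
  fixes f :: "real \<Rightarrow> 'v::real_normed_vector"
  assumes "cadlag_on T f" "0 < T" "0 < \<delta>" "\<delta> \<le> \<delta>'"
  shows "osc_M1 T f \<delta> \<le> osc_M1 T f \<delta>'"
  using assms by (intro osc_M1_leI) (auto intro: seg_dist_le_osc)

text \<open>
  A window shorter than the Lebesgue number lies in one interval of the cover. The middle time lies on
  one side of its centre \<open>a\<close>, together with one of the two end times, and on each side
  \<open>f\<close> is almost constant.
\<close>

lemma cadlag_osc_small:
  fixes f :: "real \<Rightarrow> 'v::real_normed_vector"
  assumes f: "cadlag_on T f" and T: "0 < T" and e: "0 < e"
  obtains \<delta> where "0 < \<delta>" "osc_M1 T f \<delta> \<le> e"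
proof -
  obtain d where d: "\<And>a. a \<in> {0..T} \<Longrightarrow> 0 < d a"
    and dl: "\<And>a t. a \<in> {0..T} \<Longrightarrow> 0 \<le> t \<Longrightarrow> a - d a < t \<Longrightarrow> t < a \<Longrightarrow>
       norm (f t - left_lim f a) \<le> e/2 \<and> norm (left_lim f t - left_lim f a) \<le> e/2"
    and dr: "\<And>a t. a \<in> {0..T} \<Longrightarrow> t \<le> T \<Longrightarrow> a < t \<Longrightarrow> t < a + d a \<Longrightarrow>
       norm (f t - f a) \<le> e/2 \<and> norm (left_lim f t - f a) \<le> e/2"
    using cadlag_cover[OF f half_gt_zero[OF e] less_imp_le[OF T]] by blast
  let ?\<C> = "(\<lambda>a. ball a (d a)) ` {0..T}"
  have ne: "?\<C> \<noteq> {}" using T by simp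
  have cov: "{0..T} \<subseteq> \<Union>?\<C>"
  proof
    fix a assume "a \<in> {0..T}"
    then show "a \<in> \<Union>?\<C>" using d by (intro UnionI[of "ball a (d a)"]) auto
  qed
  have "\<And>B. B \<in> ?\<C> \<Longrightarrow> open B" by auto
  then obtain D where D: "0 < D" "\<And>S. S \<subseteq> {0..T} \<Longrightarrow> diameter S < D \<Longrightarrow> \<exists>B\<in>?\<C>. S \<subseteq> B"
    by (rule Lebesgue_number_lemma[OF compact_Icc ne cov]) auto
  have "seg_dist (f t1) (f t) (f t2) \<le> e"
    if t: "0 \<le> t1" "t1 < t" "t < t2" "t2 \<le> T" "t2 - t1 \<le> D / 2" for t1 t t2
  proof -
    obtain a where a: "a \<in> {0..T}" "{t1..t2} \<subseteq> ball a (d a)"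
      using D(2)[of "{t1..t2}"] D(1) t by auto
    have in_ball: "\<bar>s - a\<bar> < d a" if "s \<in> {t1..t2}" for s
      using a(2) that by (auto simp: dist_real_def abs_minus_commute)
    show ?thesis
    proof (cases "t < a")
      case True
      have "norm (f t1 - left_lim f a) \<le> e/2" "norm (f t - left_lim f a) \<le> e/2"
        using dl[of a t1] dl[of a t] in_ball[of t1] in_ball[of t] a t True by auto
      then have "norm (f t - f t1) \<le> e"
        using norm_triangle_ineq4[of "f t - left_lim f a" "f t1 - left_lim f a"] by simp
      then show ?thesis by (auto simp: seg_dist_le_iff intro!: bexI[of _ "f t1"])
    next
      case False
      have "norm (f t2 - f a) \<le> e/2" "norm (f t - f a) \<le> e/2"
        using dr[of a t2] dr[of a t] in_ball[of t2] in_ball[of t] a t False e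
        by (cases "t = a"; auto)+
      then have "norm (f t - f t2) \<le> e"
        using norm_triangle_ineq4[of "f t - f a" "f t2 - f a"] by simp
      then show ?thesis by (auto simp: seg_dist_le_iff intro!: bexI[of _ "f t2"])
    qed
  qed
  then show ?thesis
    using D(1) T by (intro that[of "D/2"] osc_M1_leI) auto
qed

lemma osc_M1_tendsto_0:
  fixes f :: "real \<Rightarrow> 'v::real_normed_vector"
  assumes f: "cadlag_on T f" and T: "0 < T"
  shows "((\<lambda>\<delta>. osc_M1 T f \<delta>) \<longlongrightarrow> 0) (at_right 0)"
proof (rule tendstoI)
  fix e :: real assume "0 < e"
  then obtain d where d: "0 < d" "osc_M1 T f d \<le> e/2"
    using cadlag_osc_small[OF f T, of "e/2"] by auto
  have "dist (osc_M1 T f \<delta>) 0 < e" if "0 < \<delta>" "\<delta> < d" for \<delta>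
    using osc_M1_mono[OF f T that(1), of d] osc_M1_nonneg[OF f T that(1)] that d \<open>0 < e\<close> by simp
  then show "\<forall>\<^sub>F \<delta> in at_right 0. dist (osc_M1 T f \<delta>) 0 < e"
    using d(1) by (auto simp: eventually_at_right[of 0 1] intro!: exI[of _ d])
qed

section \<open>Oscillation along the extended graph\<close>

text \<open>
  The two values that \<open>f\<close> takes at \<open>t\<close>, ordered as \<open>False <
  True\<close>: \<open>False\<close> selects the left limit. Pairs \<open>(t, \<sigma>)\<close> in
  lexicographic order are the ends of the jump segments in the order of the extended graph.
\<close>

definition side_val :: "(real \<Rightarrow> 'v::t2_space) \<Rightarrow> real \<Rightarrow> bool \<Rightarrow> 'v" where
  "side_val f t \<sigma> = (if \<sigma> then f t else left_lim f t)"

lemma side_val_simps [simp]: "side_val f t True = f t" "side_val f t False = left_lim f t"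
  by (simp_all add: side_val_def)

lemma left_lim_upperbound:
  fixes f :: "real \<Rightarrow> 'v::real_normed_vector"
  assumes f: "cadlag_on T f" and t: "0 < t" "t \<le> T" and c: "c < t"
    and g: "((\<lambda>s. G (f s)) \<longlongrightarrow> G (left_lim f t)) (at_left t)"
    and le: "\<And>s. c < s \<Longrightarrow> s < t \<Longrightarrow> G (f s) \<le> (m::real)"
  shows "G (left_lim f t) \<le> m"
proof -
  have "\<forall>\<^sub>F s in at_left t. G (f s) \<le> m"
    using le c by (auto simp: eventually_at_left[OF c] intro!: exI[of _ c])
  then show ?thesis
    by (rule tendsto_upperbound[OF g]) simp
qed

text \<open>
  The next three lemmas admit left limits as first, second and third entry of a triple, one entry at a
  time. The window is required to be strictly shorter than \<open>\<delta>\<close> so that the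
  approximating times still fit into it.
\<close>

lemma seg_dist_side_left:
  fixes f :: "real \<Rightarrow> 'v::real_normed_vector"
  assumes f: "cadlag_on T f" and T: "0 < T" and \<delta>: "0 < \<delta>"
    and t: "0 \<le> t1" "t1 \<le> t" "t \<le> t2" "t2 \<le> T" "t2 - t1 < \<delta>"
  shows "seg_dist (side_val f t1 \<sigma>) (f t) (f t2) \<le> osc_M1 T f \<delta>"
proof -
  have val: "seg_dist (f t1) (f t) (f t2) \<le> osc_M1 T f \<delta>"
    if "0 \<le> t1" "t1 \<le> t" "t \<le> t2" "t2 \<le> T" "t2 - t1 \<le> \<delta>" for t1 t t2
    using that osc_M1_nonneg[OF f T \<delta>] by (cases "t1 = t \<or> t = t2") (auto intro: seg_dist_le_osc[OF f])
  show ?thesis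
  proof (cases "\<sigma> \<or> t1 = 0")
    case True
    then show ?thesis using val t by (cases \<sigma>) auto
  next
    case False
    have "seg_dist (left_lim f t1) (f t) (f t2) \<le> osc_M1 T f \<delta>"
    proof (rule left_lim_upperbound[OF f, where G = "\<lambda>z. seg_dist z (f t) (f t2)"])
      show "max 0 (t2 - \<delta>) < t1" using False t by auto
      show "((\<lambda>s. seg_dist (f s) (f t) (f t2)) \<longlongrightarrow> seg_dist (left_lim f t1) (f t) (f t2)) (at_left t1)"
        using False t by (intro tendsto_intros cadlag_tendsto_left[OF f]) auto
    qed (use False t val in auto)
    then show ?thesis using False by simp
  qed
qed

lemma seg_dist_side_mid:
  fixes f :: "real \<Rightarrow> 'v::real_normed_vector"
  assumes f: "cadlag_on T f" and T: "0 < T" and \<delta>: "0 < \<delta>"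
    and t: "0 \<le> t1" "t1 < t \<or> t1 = t \<and> \<sigma>1 \<le> \<sigma>" "t \<le> t2" "t2 \<le> T" "t2 - t1 < \<delta>"
  shows "seg_dist (side_val f t1 \<sigma>1) (side_val f t \<sigma>) (f t2) \<le> osc_M1 T f \<delta>"
proof (cases "\<sigma> \<or> t1 = t")
  case True
  then show ?thesis
    using t seg_dist_side_left[OF f T \<delta>, of t1 t t2 \<sigma>1] osc_M1_nonneg[OF f T \<delta>]
    by (cases \<sigma>; cases \<sigma>1) auto
next
  case False
  have "seg_dist (side_val f t1 \<sigma>1) (left_lim f t) (f t2) \<le> osc_M1 T f \<delta>"
  proof (rule left_lim_upperbound[OF f, where G = "\<lambda>z. seg_dist (side_val f t1 \<sigma>1) z (f t2)"])
    show "t1 < t" using False t by auto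
    show "((\<lambda>s. seg_dist (side_val f t1 \<sigma>1) (f s) (f t2))
            \<longlongrightarrow> seg_dist (side_val f t1 \<sigma>1) (left_lim f t) (f t2)) (at_left t)"
      using False t by (intro tendsto_intros cadlag_tendsto_left[OF f]) auto
  qed (use False t seg_dist_side_left[OF f T \<delta>] in auto)
  then show ?thesis using False by simp
qed

lemma seg_dist_side:
  fixes f :: "real \<Rightarrow> 'v::real_normed_vector"
  assumes f: "cadlag_on T f" and T: "0 < T" and \<delta>: "0 < \<delta>"
    and t: "0 \<le> t1" "t1 < t \<or> t1 = t \<and> \<sigma>1 \<le> \<sigma>" "t < t2 \<or> t = t2 \<and> \<sigma> \<le> \<sigma>2" "t2 \<le> T" "t2 - t1 < \<delta>"
  shows "seg_dist (side_val f t1 \<sigma>1) (side_val f t \<sigma>) (side_val f t2 \<sigma>2) \<le> osc_M1 T f \<delta>"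
proof (cases "\<sigma>2 \<or> t = t2")
  case True
  then show ?thesis
    using t seg_dist_side_mid[OF f T \<delta>, of t1 t \<sigma>1 \<sigma> t2] osc_M1_nonneg[OF f T \<delta>]
    by (cases \<sigma>2; cases \<sigma>) auto
next
  case False
  have "seg_dist (side_val f t1 \<sigma>1) (side_val f t \<sigma>) (left_lim f t2) \<le> osc_M1 T f \<delta>"
  proof (rule left_lim_upperbound[OF f, where G = "\<lambda>z. seg_dist (side_val f t1 \<sigma>1) (side_val f t \<sigma>) z"])
    show "t < t2" using False t by auto
    show "((\<lambda>s. seg_dist (side_val f t1 \<sigma>1) (side_val f t \<sigma>) (f s))
            \<longlongrightarrow> seg_dist (side_val f t1 \<sigma>1) (side_val f t \<sigma>) (left_lim f t2)) (at_left t2)"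
      using False t by (intro tendsto_intros cadlag_tendsto_left[OF f]) auto
  qed (use False t seg_dist_side_mid[OF f T \<delta>] in auto)
  then show ?thesis using False by simp
qed

text \<open>
  The factor \<open>9\<close> arises by applying the extension lemma, which costs a factor
  \<open>3\<close>, to the left and then to the right end point of the triple.
\<close>

lemma seg_dist_extended_graph:
  fixes f :: "real \<Rightarrow> 'v::real_normed_vector"
  assumes f: "cadlag_on T f" and T: "0 < T" and \<delta>: "0 < \<delta>"
    and p1: "(t1, v1) \<in> extended_graph T f" and p: "(t, v) \<in> extended_graph T f"
    and p2: "(t2, v2) \<in> extended_graph T f"
    and le1: "graph_le f (t1, v1) (t, v)" and le2: "graph_le f (t, v) (t2, v2)"
    and len: "t2 - t1 < \<delta>"
  shows "seg_dist v1 v v2 \<le> 9 * osc_M1 T f \<delta>"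
proof -
  define m where "m = osc_M1 T f \<delta>"
  have m: "0 \<le> m" using osc_M1_nonneg[OF f T \<delta>] by (simp add: m_def)
  have t: "0 \<le> t1" "t2 \<le> T" "t1 \<le> t" "t \<le> t2"
    and v1: "v1 \<in> closed_segment (left_lim f t1) (f t1)"
    and v: "v \<in> closed_segment (left_lim f t) (f t)"
    and v2: "v2 \<in> closed_segment (left_lim f t2) (f t2)"
    using p1 p p2 le1 le2 by (auto simp: extended_graph_def graph_le_def)
  have side: "seg_dist (side_val f t1 \<sigma>1) (side_val f s \<sigma>) (side_val f t2 \<sigma>2) \<le> m"
    if "t1 < s \<or> t1 = s \<and> \<sigma>1 \<le> \<sigma>" "s < t2 \<or> s = t2 \<and> \<sigma> \<le> \<sigma>2" for s \<sigma>1 \<sigma> \<sigma>2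
    unfolding m_def using that t len by (intro seg_dist_side[OF f T \<delta>]) auto
  \<comment> \<open>Move the left end into its jump segment.\<close>
  have left: "seg_dist v1 (side_val f s \<sigma>) (side_val f t2 \<sigma>2) \<le> 3 * m"
    if "t1 < s \<or> t1 = s \<and> \<sigma>" "s < t2 \<or> s = t2 \<and> \<sigma> \<le> \<sigma>2" for s \<sigma> \<sigma>2
    using that side[of t1 False True \<sigma>2] side[of s True \<sigma> \<sigma>2]
    by (intro seg_dist_extend_left[OF _ _ v1]) auto
  \<comment> \<open>Move the right end into its jump segment.\<close>
  have both: "seg_dist v1 (side_val f s \<sigma>) v2 \<le> 9 * m"
    if "t1 < t2" "t1 < s \<or> t1 = s \<and> \<sigma>" "s < t2 \<or> s = t2 \<and> \<not> \<sigma>" for s \<sigma>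
    using left[of t2 False True] left[of s \<sigma> False] v2 that
      seg_dist_extend_right[of v1 "left_lim f t2" "f t2" "3 * m" "side_val f s \<sigma>" v2] by auto
  have "seg_dist v1 v v2 \<le> 9 * m"
  proof (cases "t1 < t"; cases "t < t2")
    assume "t1 < t" "t < t2"
    then show ?thesis
      using both[of t False] both[of t True] v
      by - (rule seg_dist_convex[of v1 "left_lim f t" v2 _ "f t"], auto)
  next
    assume *: "t1 < t" "\<not> t < t2"
    then have "t = t2" using t by simp
    then have "v \<in> closed_segment (left_lim f t) v2"
      using le2 v v2 by - (rule segment_ordered(1)[of v _ "f t"], auto simp: graph_le_def)
    then show ?thesis
      using both[of t False] * \<open>t = t2\<close> m
      by - (rule seg_dist_convex[of v1 "left_lim f t" v2 _ v2], auto)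
  next
    assume *: "\<not> t1 < t" "t < t2"
    then have "t = t1" using t by simp
    then have "v \<in> closed_segment v1 (f t)"
      using le1 v v1 by - (rule segment_ordered(2)[of v1 "left_lim f t" "f t"], auto simp: graph_le_def)
    then show ?thesis
      using both[of t True] * \<open>t = t1\<close> m
      by - (rule seg_dist_convex[of v1 v1 v2 _ "f t"], auto)
  next
    assume "\<not> t1 < t" "\<not> t < t2"
    then have eq: "t1 = t" "t2 = t" using t by auto
    then have le: "norm (left_lim f t - v1) \<le> norm (left_lim f t - v)"
      "norm (left_lim f t - v) \<le> norm (left_lim f t - v2)"
      using le1 le2 by (auto simp: graph_le_def)
    have "v1 \<in> closed_segment (left_lim f t) v2"
      using le v1 v2 eq by - (rule segment_ordered(1)[of v1 "left_lim f t" "f t" v2], auto)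
    moreover have "v \<in> closed_segment (left_lim f t) v2"
      using le v v2 eq by - (rule segment_ordered(1)[of v "left_lim f t" "f t" v2], auto)
    ultimately have "v \<in> closed_segment v1 v2"
      using le(1) by (rule segment_ordered(2))
    then show ?thesis using m by (simp add: seg_dist_eq_0)
  qed
  then show ?thesis by (simp add: m_def)
qed

lemma extended_graph_antisym:
  assumes "p \<in> extended_graph T f" "q \<in> extended_graph T f" "graph_le f p q" "graph_le f q p"
  shows "p = q"
proof -
  obtain t v w where pq: "p = (t, v)" "q = (t, w)"
    and n: "norm (left_lim f t - v) = norm (left_lim f t - w)"
    using assms(3,4) by (cases p; cases q) (auto simp: graph_le_def)
  obtain a b where a: "v = (1 - a) *\<^sub>R left_lim f t + a *\<^sub>R f t" "0 \<le> a"
    and b: "w = (1 - b) *\<^sub>R left_lim f t + b *\<^sub>R f t" "0 \<le> b"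
    using assms(1,2) pq by (auto simp: extended_graph_def closed_segment_def)
  have "left_lim f t - v = a *\<^sub>R (left_lim f t - f t)" "left_lim f t - w = b *\<^sub>R (left_lim f t - f t)"
    by (simp_all add: a(1) b(1) algebra_simps)
  then have "a = b \<or> left_lim f t = f t"
    using n a(2) b(2) by auto
  then have "v = w"
  proof
    assume "left_lim f t = f t"
    then show ?thesis
      using a(1) b(1) by (simp add: scaleR_left_distrib[symmetric])
  qed (simp add: a(1) b(1))
  then show ?thesis using pq by simp
qed

section \<open>Piecewise linear interpolation\<close>

text \<open>
  The ramps add up to a function that climbs from \<open>x i\<close> to \<open>x (i + 1)\<close> on
  \<open>[i, i + 1]\<close>. Writing the interpolation as one sum makes continuity and monotonicity
  immediate.
\<close>

definition interp :: "nat \<Rightarrow> (nat \<Rightarrow> 'v::real_normed_vector) \<Rightarrow> real \<Rightarrow> 'v" where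
  "interp n x z = x 0 + (\<Sum>i<n. max 0 (min 1 (z - real i)) *\<^sub>R (x (Suc i) - x i))"

text \<open>
  A staircase with one step in progress. This evaluates the interpolation, and also the sum of the
  clocks of all cells of a grid.
\<close>

lemma sum_staircase:
  fixes d :: "nat \<Rightarrow> 'v::real_vector"
  assumes "j < n" "\<And>i. i < j \<Longrightarrow> l i = 1" "\<And>i. j < i \<Longrightarrow> i < n \<Longrightarrow> l i = 0"
  shows "(\<Sum>i<n. l i *\<^sub>R d i) = (\<Sum>i<j. d i) + l j *\<^sub>R d j"
proof -
  have "(\<Sum>i<n. l i *\<^sub>R d i) = (\<Sum>i<Suc j. l i *\<^sub>R d i)"
    using assms by (intro sum.mono_neutral_right) auto
  also have "\<dots> = (\<Sum>i<j. d i) + l j *\<^sub>R d j"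
    using assms(2) by simp
  finally show ?thesis .
qed

lemma interp_cell:
  assumes "j < n" "real j \<le> z" "z \<le> real j + 1"
  shows "interp n x z = x j + (z - real j) *\<^sub>R (x (Suc j) - x j)"
proof -
  have "(\<Sum>i<n. max 0 (min 1 (z - real i)) *\<^sub>R (x (Suc i) - x i)) =
    (\<Sum>i<j. x (Suc i) - x i) + max 0 (min 1 (z - real j)) *\<^sub>R (x (Suc j) - x j)"
    using assms by (intro sum_staircase) auto
  also have "\<dots> = x j - x 0 + (z - real j) *\<^sub>R (x (Suc j) - x j)"
    using assms by (simp add: sum_lessThan_telescope)
  finally show ?thesis by (simp add: interp_def)
qed

lemma interp_grid: "i \<le> n \<Longrightarrow> interp n x (real i) = x i"
proof (cases "i = n")
  case True
  then show ?thesis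
    by (cases n) (simp add: interp_def, use interp_cell[of "n - 1" n "real n" x] in simp)
next
  case False
  assume "i \<le> n"
  then show ?thesis using False interp_cell[of i n "real i" x] by simp
qed

lemma continuous_interp: "continuous_on A (interp n x)"
  unfolding interp_def by (intro continuous_intros)

lemma interp_mono:
  fixes x :: "nat \<Rightarrow> real"
  assumes "\<And>i. i < n \<Longrightarrow> x i \<le> x (Suc i)"
  shows "mono (interp n x)"
  unfolding interp_def real_scaleR_def
  by (intro monoI add_left_mono sum_mono mult_right_mono) (use assms in auto)

lemma partition_cell:
  fixes c :: "nat \<Rightarrow> real"
  assumes "0 < n" "c 0 \<le> s" "s \<le> c n"
  shows "\<exists>j<n. c j \<le> s \<and> s \<le> c (Suc j)"
  using assms
proof (induction n)
  case (Suc n)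
  show ?case
  proof (cases "c n \<le> s")
    case True
    then show ?thesis using Suc.prems by auto
  next
    case False
    then have "0 < n" using Suc.prems by (cases n) auto
    then show ?thesis using Suc False by (meson less_SucI linear)
  qed
qed simp

lemma interp_diff_le:
  assumes "0 < n" "0 \<le> z" "z \<le> real n" and xy: "\<And>i. i \<le> n \<Longrightarrow> norm (x i - y i) \<le> e"
  shows "norm (interp n x z - interp n y z) \<le> e"
proof -
  obtain j where j: "j < n" "real j \<le> z" "z \<le> real j + 1"
    using partition_cell[of n real z] assms by (auto simp: add.commute)
  define \<theta> where "\<theta> = z - real j"
  have \<theta>: "0 \<le> \<theta>" "\<theta> \<le> 1" using j by (auto simp: \<theta>_def)
  have "interp n x z - interp n y z = (1 - \<theta>) *\<^sub>R (x j - y j) + \<theta> *\<^sub>R (x (Suc j) - y (Suc j))"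
    unfolding interp_cell[OF j] \<theta>_def[symmetric] by (simp add: algebra_simps)
  also have "norm \<dots> \<le> (1 - \<theta>) * norm (x j - y j) + \<theta> * norm (x (Suc j) - y (Suc j))"
    using \<theta> by (intro order_trans[OF norm_triangle_ineq]) auto
  also have "\<dots> \<le> e"
    using \<theta> j(1) by (intro convex_bound_le xy) auto
  finally show ?thesis .
qed

section \<open>Parametric representations\<close>

lemma param_reps_mono:
  assumes "(r, u) \<in> param_reps T f" "0 \<le> s" "s \<le> s'" "s' \<le> 1"
  shows "graph_le f (r s, u s) (r s', u s')" "r s \<le> r s'"
proof -
  show "graph_le f (r s, u s) (r s', u s')"
    using assms unfolding param_reps_def by auto
  then show "r s \<le> r s'"
    by (auto simp: graph_le_def)
qed

lemma param_reps_mem: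
  assumes "(r, u) \<in> param_reps T f" "0 \<le> s" "s \<le> 1"
  shows "(r s, u s) \<in> extended_graph T f"
proof -
  have "(r s, u s) \<in> (\<lambda>s. (r s, u s)) ` {0..1}" using assms by auto
  then show ?thesis using assms by (auto simp: param_reps_def)
qed

lemma param_reps_surj:
  assumes "(r, u) \<in> param_reps T f" "p \<in> extended_graph T f"
  obtains s where "0 \<le> s" "s \<le> 1" "(r s, u s) = p"
proof -
  have "p \<in> (\<lambda>s. (r s, u s)) ` {0..1}" using assms by (auto simp: param_reps_def)
  then show ?thesis using that by auto
qed

lemma graph_in_extended_graph: "t \<in> {0..T} \<Longrightarrow> (t, f t) \<in> extended_graph T f"
  by (simp add: extended_graph_def)

lemma param_reps_continuous:
  assumes "(r, u) \<in> param_reps T f"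
  shows "continuous_on {0..1} (\<lambda>s. (r s, u s))" "continuous_on {0..1} r" "continuous_on {0..1} u"
proof -
  show *: "continuous_on {0..1} (\<lambda>s. (r s, u s))" using assms by (simp add: param_reps_def)
  show "continuous_on {0..1} r" "continuous_on {0..1} u"
    using continuous_on_fst[OF *] continuous_on_snd[OF *] by simp_all
qed

lemma continuous_mono_image:
  fixes \<rho> :: "real \<Rightarrow> real"
  assumes "continuous_on {a..b} \<rho>" "mono_on {a..b} \<rho>" "a \<le> b"
  shows "\<rho> ` {a..b} = {\<rho> a..\<rho> b}"
proof
  show "\<rho> ` {a..b} \<subseteq> {\<rho> a..\<rho> b}"
    using mono_onD[OF assms(2)] assms(3) by (auto simp: image_subset_iff)
  show "{\<rho> a..\<rho> b} \<subseteq> \<rho> ` {a..b}"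
  proof
    fix y assume "y \<in> {\<rho> a..\<rho> b}"
    then obtain x where "a \<le> x" "x \<le> b" "\<rho> x = y"
      using IVT'[of \<rho> a y b] assms by auto
    then show "y \<in> \<rho> ` {a..b}" by auto
  qed
qed

lemma param_reps_reparam:
  assumes ru: "(r, u) \<in> param_reps T f"
    and l: "continuous_on {0..1} l" "mono_on {0..1} l" "l 0 = 0" "l 1 = (1::real)"
  shows "(\<lambda>s. r (l s), \<lambda>s. u (l s)) \<in> param_reps T f"
proof -
  have im: "l ` {0..1} = {0..1}"
    using continuous_mono_image[OF l(1,2)] l(3,4) by simp
  have "continuous_on {0..1} (\<lambda>s. (r (l s), u (l s)))"
    using continuous_on_compose2[OF param_reps_continuous(1)[OF ru] l(1)] im by simp
  moreover have "(\<lambda>s. (r (l s), u (l s))) ` {0..1} = extended_graph T f"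
  proof -
    have "(\<lambda>s. (r (l s), u (l s))) ` {0..1} = (\<lambda>s. (r s, u s)) ` (l ` {0..1})"
      by (simp add: image_image)
    then show ?thesis using ru im by (simp add: param_reps_def)
  qed
  moreover have "graph_le f (r (l s), u (l s)) (r (l s'), u (l s'))"
    if "s \<in> {0..1}" "s' \<in> {0..1}" "s \<le> s'" for s s'
    using that l mono_onD[OF l(2), of 0 s] mono_onD[OF l(2), of s s'] mono_onD[OF l(2), of s' 1]
    by (intro param_reps_mono[OF ru]) auto
  ultimately show ?thesis
    using ru l by (simp add: param_reps_def)
qed

text \<open>
  Without jumps the extended graph is the graph, so each monotone time change of \<open>[0,1]\<close>
  onto \<open>[0,T]\<close> represents it.
\<close>

lemma param_reps_continuous_fun:
  assumes f: "continuous_on UNIV f" and T: "0 < T"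
    and r: "continuous_on {0..1} r" "mono_on {0..1} r" "r 0 = 0" "r 1 = T"
  shows "(r, \<lambda>s. f (r s)) \<in> param_reps T f"
proof -
  have ll: "left_lim f t = f t" for t
    using f by (intro continuous_left_lim) (simp add: continuous_on_eq_continuous_at)
  have im: "r ` {0..1} = {0..T}"
    using continuous_mono_image[OF r(1,2)] r(3,4) by simp
  have "continuous_on {0..1} (\<lambda>s. (r s, f (r s)))"
    by (intro continuous_on_Pair r(1) continuous_on_compose2[OF f r(1)]) auto
  moreover have "(\<lambda>s. (r s, f (r s))) ` {0..1} = (\<lambda>t. (t, f t)) ` (r ` {0..1})"
    by (simp add: image_image)
  then have "(\<lambda>s. (r s, f (r s))) ` {0..1} = extended_graph T f"
    unfolding im by (auto simp: extended_graph_def ll)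
  moreover have "graph_le f (r s, f (r s)) (r s', f (r s'))"
    if "s \<in> {0..1}" "s' \<in> {0..1}" "s \<le> s'" for s s'
    using mono_onD[OF r(2) that] by (cases "r s = r s'") (auto simp: graph_le_def)
  ultimately show ?thesis
    using r by (simp add: param_reps_def)
qed

text \<open>
  Both representations pass through the points \<open>Q(i/N)\<close> of the second one, in the same
  order. Let \<open>l\<close> be piecewise linear and send \<open>i/N\<close> to a time at which the
  first one is there. Between two such points, \<open>P \<circ> l\<close> and \<open>Q\<close> run
  through the same piece of the graph, which is covered by \<open>Q\<close> on an interval of length
  \<open>1/N\<close> so that any two of its points are less than \<open>e\<close> apart.
\<close>

lemma approx_reparam:
  assumes T: "0 < T" and ru: "(r, u) \<in> param_reps T f" and ru': "(r', u') \<in> param_reps T f"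
    and e: "0 < e"
  obtains l where "continuous_on {0..1} l" "mono_on {0..1} l" "l 0 = 0" "l 1 = (1::real)"
    "\<And>s. 0 \<le> s \<Longrightarrow> s \<le> 1 \<Longrightarrow> \<bar>r (l s) - r' s\<bar> \<le> e \<and> norm (u (l s) - u' s) \<le> e"
proof -
  define P where "P s = (r s, u s)" for s
  define Q where "Q s = (r' s, u' s)" for s
  have ends: "P 0 = (0, f 0)" "P 1 = (T, f T)" "Q 0 = (0, f 0)" "Q 1 = (T, f T)"
    using ru ru' by (auto simp: param_reps_def P_def Q_def)
  obtain d where d: "0 < d"
    "\<And>s s'. s \<in> {0..1} \<Longrightarrow> s' \<in> {0..1} \<Longrightarrow> dist s' s < d \<Longrightarrow> dist (Q s') (Q s) < e"
    using compact_uniformly_continuous[OF param_reps_continuous(1)[OF ru'] compact_Icc] e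
    unfolding uniformly_continuous_on_def Q_def by metis
  obtain n where n: "inverse (real (Suc n)) < d"
    using reals_Archimedean[OF d(1)] by blast
  define N where "N = Suc n"
  have N: "0 < N" "1 / real N < d" using n by (auto simp: N_def inverse_eq_divide)
  have Q_grid: "Q (real i / real N) \<in> extended_graph T f" if "i \<le> N" for i
    unfolding Q_def using that N by (intro param_reps_mem[OF ru']) auto
  \<comment> \<open>The preimage depends only on the graph point, which makes \<open>c\<close> below monotone even if \<open>Q\<close> rests.
    The end points are prescribed since \<open>P\<close> may rest there too.\<close>
  define \<phi> where "\<phi> p = (if p = (0, f 0) then 0 else if p = (T, f T) then 1
     else SOME s. 0 \<le> s \<and> s \<le> 1 \<and> P s = p)" for p
  have \<phi>: "0 \<le> \<phi> p \<and> \<phi> p \<le> 1 \<and> P (\<phi> p) = p" if p: "p \<in> extended_graph T f" for p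
  proof -
    have "\<exists>s. 0 \<le> s \<and> s \<le> 1 \<and> P s = p"
      using param_reps_surj[OF ru p] by (metis P_def)
    then have "0 \<le> (SOME s. 0 \<le> s \<and> s \<le> 1 \<and> P s = p) \<and> (SOME s. 0 \<le> s \<and> s \<le> 1 \<and> P s = p) \<le> 1
        \<and> P (SOME s. 0 \<le> s \<and> s \<le> 1 \<and> P s = p) = p"
      by (rule someI_ex)
    then show ?thesis by (auto simp: \<phi>_def ends)
  qed
  define c where "c i = \<phi> (Q (real i / real N))" for i
  have c: "0 \<le> c i" "c i \<le> 1" "P (c i) = Q (real i / real N)" if "i \<le> N" for i
    using \<phi>[OF Q_grid[OF that]] by (auto simp: c_def)
  have c0: "c 0 = 0" and cN: "c N = 1"
    using N(1) T by (auto simp: c_def ends \<phi>_def)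
  have c_mono: "c i \<le> c (Suc i)" if i: "i < N" for i
  proof (rule ccontr)
    assume "\<not> c i \<le> c (Suc i)"
    then have "graph_le f (P (c (Suc i))) (P (c i))"
      unfolding P_def using c i by (intro param_reps_mono[OF ru]) auto
    moreover have "graph_le f (Q (real i / real N)) (Q (real (Suc i) / real N))"
      unfolding Q_def using i by (intro param_reps_mono[OF ru']) (auto simp: divide_simps)
    ultimately have "Q (real i / real N) = Q (real (Suc i) / real N)"
      using c(3) i Q_grid[of i] Q_grid[of "Suc i"] by (intro extended_graph_antisym[of _ T f]) auto
    then have "c i = c (Suc i)" unfolding c_def by simp
    then show False using \<open>\<not> c i \<le> c (Suc i)\<close> by simp
  qed
  define l where "l s = interp N c (real N * s)" for s
  have l_mono: "mono l"
  proof (rule monoI)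
    fix s t :: real assume "s \<le> t"
    then show "l s \<le> l t"
      unfolding l_def by (intro monoD[OF interp_mono] c_mono mult_left_mono) auto
  qed
  have l_grid: "l (real i / real N) = c i" if "i \<le> N" for i
    using interp_grid[OF that, of c] N by (simp add: l_def)
  have l_ends: "l 0 = 0" "l 1 = 1"
    using l_grid[of 0] l_grid[of N] N c0 cN by auto
  have l_cont: "continuous_on {0..1} l"
    unfolding l_def by (rule continuous_on_compose2[OF continuous_interp[of UNIV]]) (auto intro!: continuous_intros)
  have close: "dist (P (l s)) (Q s) < e" if s: "0 \<le> s" "s \<le> 1" for s
  proof -
    obtain j where j: "j < N" "real j \<le> real N * s" "real N * s \<le> real (Suc j)"
      using partition_cell[of N real "real N * s"] N s by (auto intro: mult_left_le)
    define a where "a = real j / real N"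
    define b where "b = real (Suc j) / real N"
    have ab: "a \<le> s" "s \<le> b" "0 \<le> a" "b \<le> 1" "a \<le> b" "b - a < d"
      using j N by (auto simp: a_def b_def field_simps)
    have ls: "0 \<le> l s" "l s \<le> 1"
      using l_mono s l_ends by (metis monoD)+
    obtain \<sigma> where \<sigma>: "0 \<le> \<sigma>" "\<sigma> \<le> 1" "Q \<sigma> = P (l s)"
      using param_reps_surj[OF ru' param_reps_mem[OF ru ls]] by (auto simp: P_def Q_def)
    have Pa: "P (l a) = Q a" and Pb: "P (l b) = Q b"
      using l_grid[of j] l_grid[of "Suc j"] c(3)[of j] c(3)[of "Suc j"] j(1) by (auto simp: a_def b_def)
    have Q_mem: "Q x \<in> extended_graph T f" if "0 \<le> x" "x \<le> 1" for x
      unfolding Q_def using that by (rule param_reps_mem[OF ru'])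
    have Q_le: "graph_le f (Q x) (Q y)" if "0 \<le> x" "x \<le> y" "y \<le> 1" for x y
      unfolding Q_def using that by (rule param_reps_mono[OF ru'])
    have "0 \<le> l a" "l b \<le> 1" "l a \<le> l s" "l s \<le> l b"
      using monoD[OF l_mono, of 0 a] monoD[OF l_mono, of b 1] monoD[OF l_mono, of a s]
        monoD[OF l_mono, of s b] ab l_ends by auto
    then have P_le: "graph_le f (Q a) (P (l s))" "graph_le f (P (l s)) (Q b)"
      unfolding Pa[symmetric] Pb[symmetric] using ls unfolding P_def
      by (auto intro!: param_reps_mono(1)[OF ru])
    have "\<exists>\<tau>\<in>{a..b}. Q \<tau> = P (l s)"
    proof -
      consider "\<sigma> < a" | "b < \<sigma>" | "\<sigma> \<in> {a..b}" by fastforce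
      then show ?thesis
      proof cases
      case 1
      then have "Q \<sigma> = Q a"
        using P_le(1) Q_le[of \<sigma> a] \<sigma> ab
        by (intro extended_graph_antisym[of _ T f] Q_mem) auto
      then show ?thesis using \<sigma>(3) ab by (intro bexI[of _ a]) auto
    next
      case 2
      then have "Q b = Q \<sigma>"
        using P_le(2) Q_le[of b \<sigma>] \<sigma> ab
        by (intro extended_graph_antisym[of _ T f] Q_mem) auto
      then show ?thesis using \<sigma>(3) ab by (intro bexI[of _ b]) auto
    next
      case 3
      then show ?thesis using \<sigma>(3) by blast
    qed
    qed
    then obtain \<tau> where "\<tau> \<in> {a..b}" "Q \<tau> = P (l s)" by blast
    then show ?thesis
      using d(2)[of s \<tau>] s ab by (auto simp: dist_real_def)
  qed
  have "\<bar>r (l s) - r' s\<bar> \<le> e \<and> norm (u (l s) - u' s) \<le> e" if "0 \<le> s" "s \<le> 1" for s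
  proof -
    have "dist (r (l s)) (r' s) \<le> dist (P (l s)) (Q s)" "dist (u (l s)) (u' s) \<le> dist (P (l s)) (Q s)"
      using dist_fst_le[of "P (l s)" "Q s"] dist_snd_le[of "P (l s)" "Q s"] by (auto simp: P_def Q_def)
    then show ?thesis using close[OF that] by (simp add: dist_norm)
  qed
  then show ?thesis
    using that[OF l_cont mono_on_subset[OF l_mono] l_ends] by auto
qed

section \<open>The distance as a pseudometric\<close>

lemma param_reps_sup:
  assumes "(r1, u1) \<in> param_reps T f" "(r2, u2) \<in> param_reps T g"
  shows "bdd_above ((\<lambda>s. \<bar>r1 s - r2 s\<bar>) ` {0..1})" "bdd_above ((\<lambda>s. norm (u1 s - u2 s)) ` {0..1})"
proof -
  have "continuous_on {0..1} (\<lambda>s. \<bar>r1 s - r2 s\<bar>)" "continuous_on {0..1} (\<lambda>s. norm (u1 s - u2 s))"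
    using assms by (auto intro!: continuous_intros dest: param_reps_continuous)
  then show "bdd_above ((\<lambda>s. \<bar>r1 s - r2 s\<bar>) ` {0..1})" "bdd_above ((\<lambda>s. norm (u1 s - u2 s)) ` {0..1})"
    by (auto intro!: bounded_imp_bdd_above compact_imp_bounded compact_continuous_image)
qed

lemma dist_M1_bdd_below:
  "bdd_below {max (SUP s\<in>{0..1}. \<bar>r1 s - r2 s\<bar>) (SUP s\<in>{0..1}. norm (u1 s - u2 s)) | r1 u1 r2 u2.
            (r1, u1) \<in> param_reps T f \<and> (r2, u2) \<in> param_reps T g}"
proof (rule bdd_belowI[of _ 0], clarify)
  fix r1 u1 r2 u2 assume "(r1, u1) \<in> param_reps T f" "(r2, u2) \<in> param_reps T g"
  then have "\<bar>r1 0 - r2 0\<bar> \<le> (SUP s\<in>{0..1}. \<bar>r1 s - r2 s\<bar>)"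
    by (intro cSUP_upper param_reps_sup) auto
  then show "0 \<le> max (SUP s\<in>{0..1}. \<bar>r1 s - r2 s\<bar>) (SUP s\<in>{0..1}. norm (u1 s - u2 s))"
    by linarith
qed

lemma dist_M1_leI:
  assumes "(r1, u1) \<in> param_reps T f" "(r2, u2) \<in> param_reps T g"
    and "\<And>s. 0 \<le> s \<Longrightarrow> s \<le> 1 \<Longrightarrow> \<bar>r1 s - r2 s\<bar> \<le> c \<and> norm (u1 s - u2 s) \<le> c"
  shows "dist_M1 T f g \<le> c"
proof -
  have "dist_M1 T f g \<le> max (SUP s\<in>{0..1}. \<bar>r1 s - r2 s\<bar>) (SUP s\<in>{0..1}. norm (u1 s - u2 s))"
    unfolding dist_M1_def using assms(1,2) by (intro cInf_lower dist_M1_bdd_below) blast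
  also have "\<dots> \<le> c"
    using assms(3) by (intro max.boundedI cSUP_least) auto
  finally show ?thesis .
qed

lemma dist_M1_lessE:
  assumes "dist_M1 T f g < c" "param_reps T f \<noteq> {}" "param_reps T g \<noteq> {}"
  obtains r1 u1 r2 u2 where "(r1, u1) \<in> param_reps T f" "(r2, u2) \<in> param_reps T g"
    "\<And>s. 0 \<le> s \<Longrightarrow> s \<le> 1 \<Longrightarrow> \<bar>r1 s - r2 s\<bar> < c \<and> norm (u1 s - u2 s) < c"
proof -
  have "{max (SUP s\<in>{0..1}. \<bar>r1 s - r2 s\<bar>) (SUP s\<in>{0..1}. norm (u1 s - u2 s)) | r1 u1 r2 u2.
            (r1, u1) \<in> param_reps T f \<and> (r2, u2) \<in> param_reps T g} \<noteq> {}"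
    using assms(2,3) by auto
  from cInf_lessD[OF this assms(1)[unfolded dist_M1_def]]
  obtain r1 u1 r2 u2 where ru: "(r1, u1) \<in> param_reps T f" "(r2, u2) \<in> param_reps T g"
    and lt: "max (SUP s\<in>{0..1}. \<bar>r1 s - r2 s\<bar>) (SUP s\<in>{0..1}. norm (u1 s - u2 s)) < c"
    by blast
  have "\<bar>r1 s - r2 s\<bar> < c \<and> norm (u1 s - u2 s) < c" if "0 \<le> s" "s \<le> 1" for s
    using cSUP_upper[OF _ param_reps_sup(1)[OF ru], of s] cSUP_upper[OF _ param_reps_sup(2)[OF ru], of s]
      that lt by auto
  then show ?thesis using that ru by blast
qed

lemma dist_M1_commute: "dist_M1 T f g = dist_M1 T g f"
  unfolding dist_M1_def
  by (rule arg_cong[of _ _ Inf]) (fastforce simp: abs_minus_commute norm_minus_commute)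

text \<open>
  Two representations of the middle function need not agree. They are matched up to \<open>e/3\<close>
  by a time change, which is then also applied to the representation of \<open>f\<close>.
\<close>

lemma dist_M1_triangle:
  assumes T: "0 < T" and ne: "param_reps T f \<noteq> {}" "param_reps T g \<noteq> {}" "param_reps T h \<noteq> {}"
  shows "dist_M1 T f h \<le> dist_M1 T f g + dist_M1 T g h"
proof (rule field_le_epsilon)
  fix e :: real assume e: "0 < e"
  have less: "x < x + e/3" for x using e by simp
  obtain r1 u1 r2 u2 where A: "(r1, u1) \<in> param_reps T f" "(r2, u2) \<in> param_reps T g"
    and A': "\<And>s. 0 \<le> s \<Longrightarrow> s \<le> 1 \<Longrightarrow>
      \<bar>r1 s - r2 s\<bar> < dist_M1 T f g + e/3 \<and> norm (u1 s - u2 s) < dist_M1 T f g + e/3"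
    by (rule dist_M1_lessE[OF less ne(1,2)]) blast
  obtain r3 u3 r4 u4 where B: "(r3, u3) \<in> param_reps T g" "(r4, u4) \<in> param_reps T h"
    and B': "\<And>s. 0 \<le> s \<Longrightarrow> s \<le> 1 \<Longrightarrow>
      \<bar>r3 s - r4 s\<bar> < dist_M1 T g h + e/3 \<and> norm (u3 s - u4 s) < dist_M1 T g h + e/3"
    by (rule dist_M1_lessE[OF less ne(2,3)]) blast
  obtain l where l: "continuous_on {0..1} l" "mono_on {0..1} l" "l 0 = 0" "l 1 = (1::real)"
    and l': "\<And>s. 0 \<le> s \<Longrightarrow> s \<le> 1 \<Longrightarrow> \<bar>r2 (l s) - r3 s\<bar> \<le> e/3 \<and> norm (u2 (l s) - u3 s) \<le> e/3"
    using approx_reparam[OF T A(2) B(1), of "e/3"] e by auto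
  show "dist_M1 T f h \<le> dist_M1 T f g + dist_M1 T g h + e"
  proof (rule dist_M1_leI[OF param_reps_reparam[OF A(1) l] B(2)])
    fix s :: real assume s: "0 \<le> s" "s \<le> 1"
    have ls: "0 \<le> l s" "l s \<le> 1"
      using mono_onD[OF l(2), of 0 s] mono_onD[OF l(2), of s 1] l s by auto
    have "norm (u1 (l s) - u4 s) \<le> norm (u1 (l s) - u2 (l s)) + norm (u2 (l s) - u3 s) + norm (u3 s - u4 s)"
      using norm_triangle_ineq[of "u1 (l s) - u2 (l s)" "u2 (l s) - u3 s"]
        norm_triangle_ineq[of "u1 (l s) - u3 s" "u3 s - u4 s"] by simp
    then show "\<bar>r1 (l s) - r4 s\<bar> \<le> dist_M1 T f g + dist_M1 T g h + e \<and>
        norm (u1 (l s) - u4 s) \<le> dist_M1 T f g + dist_M1 T g h + e"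
      using A'[OF ls] B'[OF s] l'[OF s] by linarith
  qed
qed

section \<open>Existence of parametric representations\<close>

lemma geometric_sum_indicator: "summable (\<lambda>n. (1/2) ^ n * of_bool (Q n) :: real)"
  by (rule summable_comparison_test'[OF summable_geometric[of "1/2"], of 0]) auto

text \<open>Each summand is eventually constant, and the geometric series dominates.\<close>

lemma tendsto_geometric_sum:
  fixes Q :: "'a \<Rightarrow> nat \<Rightarrow> bool"
  assumes "\<And>n. \<forall>\<^sub>F x in F. Q x n = R n" and F: "F \<noteq> bot"
  shows "((\<lambda>x. \<Sum>n. (1/2) ^ n * of_bool (Q x n) :: real) \<longlongrightarrow> (\<Sum>n. (1/2) ^ n * of_bool (R n))) F"
proof -
  have "((\<lambda>x. (1/2) ^ n * of_bool (Q x n) :: real) \<longlongrightarrow> (1/2) ^ n * of_bool (R n)) F" for n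
    by (rule tendsto_eventually, rule eventually_mono[OF assms(1)[of n]]) simp
  moreover have "summable (\<lambda>n. (1/2) ^ n :: real)" by (rule summable_geometric) simp
  moreover have "\<forall>\<^sub>F (n, x) in at_top \<times>\<^sub>F F. norm ((1/2) ^ n * of_bool (Q x n) :: real) \<le> (1/2) ^ n"
    by (intro always_eventually) auto
  ultimately show ?thesis
    using tannerys_theorem[of "\<lambda>n x. (1/2) ^ n * of_bool (Q x n)" "\<lambda>n. (1/2) ^ n * of_bool (R n)" F "\<lambda>n. (1/2) ^ n"] F
    by blast
qed

text \<open>
  Enumerate the jump times as \<open>a n\<close> and run a clock that shows \<open>t\<close> plus the
  sum of \<open>2^-n\<close> over the jumps so far. It is strictly increasing, and at a jump time
  \<open>t\<close> it leaps from \<open>lo t\<close> to \<open>hi t\<close>. Its inverse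
  \<open>R\<close> is continuous, rests at \<open>t\<close> during \<open>[lo t, hi t]\<close>, and
  this rest is used to run through the jump segment linearly.
\<close>

lemma param_reps_nonempty:
  fixes f :: "real \<Rightarrow> 'v::real_normed_vector"
  assumes f: "cadlag_on T f" and T: "0 < T"
  shows "param_reps T f \<noteq> {}"
proof -
  let ?J = "{t \<in> {0..T}. left_lim f t \<noteq> f t}"
  \<comment> \<open>If there are no jumps, \<open>a\<close> is an arbitrary sequence, at whose positive members the clock leaps in vain.\<close>
  define a where "a = from_nat_into ?J"
  have a: "\<exists>n. a n = t" if "t \<in> {0..T}" "left_lim f t \<noteq> f t" for t
    unfolding a_def using from_nat_into_surj[OF cadlag_countable_jumps[OF f less_imp_le[OF T]], of t] that by blast
  define lo where "lo t = t + (\<Sum>n. (1/2) ^ n * of_bool (0 < a n \<and> a n < t))" for t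
  define hi where "hi t = t + (\<Sum>n. (1/2) ^ n * of_bool (0 < a n \<and> a n \<le> t))" for t
  have lo_hi: "lo t \<le> hi t" for t
    unfolding lo_def hi_def by (intro add_left_mono suminf_le geometric_sum_indicator) auto
  have hi_lo: "hi s + (t - s) \<le> lo t" if "s < t" for s t
  proof -
    have "(\<Sum>n. (1/2) ^ n * of_bool (0 < a n \<and> a n \<le> s)) \<le> (\<Sum>n. (1/2) ^ n * of_bool (0 < a n \<and> a n < t) :: real)"
      using that by (intro suminf_le geometric_sum_indicator) auto
    then show ?thesis by (simp add: lo_def hi_def)
  qed
  have jump: "lo t < hi t" if t: "t \<in> {0..T}" "left_lim f t \<noteq> f t" for t
  proof -
    obtain n where n: "a n = t" using a[OF t] by blast
    have "t \<noteq> 0" using t(2) by auto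
    have "0 < (\<Sum>n. (1/2) ^ n * of_bool (0 < a n \<and> a n \<le> t) - (1/2) ^ n * of_bool (0 < a n \<and> a n < t) :: real)"
      using n t \<open>t \<noteq> 0\<close> by (intro suminf_pos2[of _ n] summable_diff geometric_sum_indicator) auto
    also have "\<dots> = (\<Sum>n. (1/2) ^ n * of_bool (0 < a n \<and> a n \<le> t)) - (\<Sum>n. (1/2) ^ n * of_bool (0 < a n \<and> a n < t))"
      by (intro suminf_diff[symmetric] geometric_sum_indicator)
    finally show ?thesis by (simp add: lo_def hi_def)
  qed
  have zero: "lo 0 = 0" "hi 0 = 0"
  proof -
    have "\<not> (0 < x \<and> x < 0)" "\<not> (0 < x \<and> x \<le> 0)" for x :: real by auto
    then show "lo 0 = 0" "hi 0 = 0" by (simp_all only: lo_def hi_def of_bool_eq mult_zero_right suminf_zero add_0_right)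
  qed
  have lo_left: "(lo \<longlongrightarrow> lo t) (at_left t)" for t
  proof -
    have "\<forall>\<^sub>F x in at_left t. (0 < a n \<and> a n < x) = (0 < a n \<and> a n < t)" for n
    proof (cases "a n < t")
      case True
      then show ?thesis by (auto simp: eventually_at_left[OF True] intro!: exI[of _ "a n"])
    next
      case False
      then show ?thesis by (auto simp: eventually_at_left[of "t - 1" t] intro!: exI[of _ "t - 1"])
    qed
    then show ?thesis
      unfolding lo_def by (intro tendsto_add tendsto_ident_at tendsto_geometric_sum) auto
  qed
  have hi_right: "(hi \<longlongrightarrow> hi t) (at_right t)" for t
  proof -
    have "\<forall>\<^sub>F x in at_right t. (0 < a n \<and> a n \<le> x) = (0 < a n \<and> a n \<le> t)" for n
    proof (cases "t < a n")
      case True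
      then show ?thesis by (auto simp: eventually_at_right[OF True] intro!: exI[of _ "a n"])
    next
      case False
      then show ?thesis by (auto simp: eventually_at_right[of t "t + 1"] intro!: exI[of _ "t + 1"])
    qed
    then show ?thesis
      unfolding hi_def by (intro tendsto_add tendsto_ident_at tendsto_geometric_sum) auto
  qed
  define Y where "Y = hi T"
  have Y: "0 < Y" using hi_lo[OF T] lo_hi[of T] zero T by (simp add: Y_def)
  have ex: "\<exists>t\<in>{0..T}. lo t \<le> y \<and> y \<le> hi t" if y: "0 \<le> y" "y \<le> Y" for y
  proof -
    define S where "S = {t \<in> {0..T}. lo t \<le> y}"
    define t where "t = Sup S"
    have S: "0 \<in> S" "bdd_above S" using y T zero by (auto simp: S_def)
    have t: "0 \<le> t" "t \<le> T"
      using S by (auto simp: t_def S_def intro!: cSup_upper cSup_least)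
    have below: "lo s \<le> y" if "s < t" for s
    proof -
      have "S \<noteq> {}" using S(1) by auto
      from less_cSupD[OF this that[unfolded t_def]] obtain x where "x \<in> S" "s < x" by blast
      then have "hi s + (x - s) \<le> lo x" "lo x \<le> y" using hi_lo[of s x] by (auto simp: S_def)
      then show ?thesis using lo_hi[of s] \<open>s < x\<close> by simp
    qed
    have "lo t \<le> y"
      by (rule tendsto_upperbound[OF lo_left]) (auto simp: eventually_at_left[of "t - 1" t] below intro!: exI[of _ "t - 1"])
    moreover have "y \<le> hi t"
    proof (cases "t = T")
      case True
      then show ?thesis using y by (simp add: Y_def)
    next
      case False
      then have "t < T" using t by simp
      have "y \<le> hi s" if "t < s" "s < T" for s
      proof (rule ccontr)
        assume "\<not> y \<le> hi s"
        then have "s \<in> S" using lo_hi[of s] that t by (auto simp: S_def)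
        then have "s \<le> t" using S by (auto simp: t_def intro!: cSup_upper)
        then show False using that by simp
      qed
      then show ?thesis
        by (intro tendsto_lowerbound[OF hi_right]) (auto simp: eventually_at_right[OF \<open>t < T\<close>] intro!: exI[of _ T] \<open>t < T\<close>)
    qed
    ultimately show ?thesis using t by auto
  qed
  define R where "R y = (SOME t. t \<in> {0..T} \<and> lo t \<le> y \<and> y \<le> hi t)" for y
  have R: "R y \<in> {0..T}" "lo (R y) \<le> y" "y \<le> hi (R y)" if "0 \<le> y" "y \<le> Y" for y
    using someI_ex[OF ex[OF that, unfolded Bex_def]] by (auto simp: R_def)
  have R_eq: "R y = t" if "0 \<le> y" "y \<le> Y" "lo t \<le> y" "y \<le> hi t" for y t
    using hi_lo[of t "R y"] hi_lo[of "R y" t] R[OF that(1,2)] that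
    by (cases t "R y" rule: linorder_cases) auto
  have R_lip: "R y' - R y \<le> y' - y" and R_mono: "R y \<le> R y'"
    if "0 \<le> y" "y \<le> y'" "y' \<le> Y" for y y'
    using hi_lo[of "R y" "R y'"] hi_lo[of "R y'" "R y"] R[of y] R[of y'] that
    by (cases "R y" "R y'" rule: linorder_cases; auto)+
  \<comment> \<open>Where \<open>f\<close> does not jump the slope is \<open>0\<close>, whether or not the clock rests there.\<close>
  define slope where "slope t = inverse (hi t - lo t) *\<^sub>R (f t - left_lim f t)" for t
  define U where "U y = left_lim f (R y) + (y - lo (R y)) *\<^sub>R slope (R y)" for y
  have U_alt: "U y = (1 - \<alpha>) *\<^sub>R left_lim f t + \<alpha> *\<^sub>R f t"
    if "t = R y" "\<alpha> = (y - lo t) / (hi t - lo t)" for y t \<alpha>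
  proof -
    have "U y = left_lim f t + \<alpha> *\<^sub>R (f t - left_lim f t)"
      using that by (simp add: U_def slope_def divide_inverse)
    then show ?thesis by (simp add: algebra_simps)
  qed
  have frac: "0 \<le> (y - lo t) / (hi t - lo t)" "(y - lo t) / (hi t - lo t) \<le> 1"
    if "lo t \<le> y" "y \<le> hi t" for y t
    using that by (auto simp: divide_simps)
  have U_seg: "U y \<in> closed_segment (left_lim f (R y)) (f (R y))" if "0 \<le> y" "y \<le> Y" for y
    using U_alt[OF refl refl, of y] frac[OF R(2,3)[OF that]] unfolding closed_segment_def by blast
  have U_lo: "U y = left_lim f t" if "R y = t" "y = lo t" for y t
    using that by (simp add: U_def)
  have U_hi: "U y = f t" if "R y = t" "y = hi t" "t \<in> {0..T}" for y t
  proof (cases "left_lim f t = f t")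
    case True
    then show ?thesis using that by (simp add: U_def slope_def)
  next
    case False
    then show ?thesis using jump[OF that(3)] that by (simp add: U_def slope_def)
  qed
  have U_cont: "continuous_on {0..Y} U"
  proof (rule continuous_on_iff[THEN iffD2], intro ballI allI impI)
    fix y0 e :: real assume y0: "y0 \<in> {0..Y}" and e: "0 < e"
    define t where "t = R y0"
    have t: "t \<in> {0..T}" "lo t \<le> y0" "y0 \<le> hi t" using R y0 by (auto simp: t_def)
    obtain d where d: "0 < d"
      and dl: "\<And>s. 0 \<le> s \<Longrightarrow> t - d < s \<Longrightarrow> s < t \<Longrightarrow> norm (f s - left_lim f t) \<le> e/3 \<and> norm (left_lim f s - left_lim f t) \<le> e/3"
      and dr: "\<And>s. s \<le> T \<Longrightarrow> t < s \<Longrightarrow> s < t + d \<Longrightarrow> norm (f s - f t) \<le> e/3 \<and> norm (left_lim f s - f t) \<le> e/3"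
      using cadlag_nbhd[OF f, of t "e/3"] t e by auto
    \<comment> \<open>A time \<open>y\<close> outside the rest at \<open>t\<close> is compared with \<open>y0\<close> via the end of the rest that lies between.\<close>
    define L where "L = norm (slope t)"
    define d' where "d' = min d (e / (3 * (L + 1)))"
    have L: "0 \<le> L" by (simp add: L_def)
    have d': "0 < d'" using d e L by (simp add: d'_def)
    have seg_near: "norm (U y - z) \<le> e/3"
      if "0 \<le> y" "y \<le> Y" "norm (f (R y) - z) \<le> e/3" "norm (left_lim f (R y) - z) \<le> e/3" for y z
    proof -
      have "closed_segment (left_lim f (R y)) (f (R y)) \<subseteq> cball z (e/3)"
        using that by (intro closed_segment_subset) (auto simp: dist_norm norm_minus_commute)
      then show ?thesis using U_seg[OF that(1,2)] by (auto simp: dist_norm norm_minus_commute)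
    qed
    have lin: "norm (U y - U y') \<le> e/3"
      if y: "lo t \<le> y" "y \<le> hi t" "lo t \<le> y'" "y' \<le> hi t" "0 \<le> y" "y \<le> Y" "0 \<le> y'" "y' \<le> Y" "\<bar>y - y'\<bar> \<le> d'" for y y'
    proof -
      have "R y = t" "R y' = t" using R_eq y by auto
      then have "U y - U y' = (y - y') *\<^sub>R slope t" by (simp add: U_def algebra_simps)
      then have "norm (U y - U y') \<le> d' * (L + 1)"
        using y(9) d' by (auto simp: L_def intro!: mult_mono)
      also have "\<dots> \<le> e / (3 * (L + 1)) * (L + 1)"
        using L by (intro mult_right_mono) (auto simp: d'_def)
      also have "\<dots> = e/3" using L by (simp add: divide_simps)
      finally show ?thesis .
    qed
    have "dist (U y) (U y0) < e" if y: "y \<in> {0..Y}" "dist y y0 < d'" for y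
    proof -
      have yd: "\<bar>y - y0\<bar> < d'" "d' \<le> d" using y by (auto simp: dist_real_def d'_def)
      consider "R y = t" | "R y < t" | "R y > t" by linarith
      then have "norm (U y - U y0) \<le> 2 * (e/3)"
      proof cases
        case 1
        then have "norm (U y - U y0) \<le> e/3"
          using R[of y] t y y0 yd by (intro lin) auto
        then show ?thesis using e by simp
      next
        case 2
        then have lt: "y \<le> y0" using R_mono[of y0 y] y y0 by (cases "y \<le> y0") (auto simp: t_def)
        have "y < lo t" using hi_lo[OF 2] R(3)[of y] y 2 by auto
        have lo_range: "0 \<le> lo t" "lo t \<le> Y" using \<open>y < lo t\<close> t y y0 by auto
        have "norm (U y - left_lim f t) \<le> e/3"
          using dl[of "R y"] R_lip[of y y0] lt y y0 yd R[of y] 2 by (intro seg_near) (auto simp: t_def)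
        moreover have "norm (U (lo t) - U y0) \<le> e/3"
          using lo_range t y0 yd lo_hi[of t] \<open>y < lo t\<close> by (intro lin) auto
        moreover have "U (lo t) = left_lim f t"
          using R_eq[of "lo t" t] lo_range lo_hi by (intro U_lo) auto
        ultimately show ?thesis
          using norm_triangle_ineq[of "U y - left_lim f t" "U (lo t) - U y0"] by simp
      next
        case 3
        then have lt: "y0 \<le> y" using R_mono[of y y0] y y0 by (cases "y0 \<le> y") (auto simp: t_def)
        have "hi t < y" using hi_lo[OF 3] R(2)[of y] y 3 by auto
        have hi_range: "0 \<le> hi t" "hi t \<le> Y" using \<open>hi t < y\<close> t y y0 by auto
        have "norm (U y - f t) \<le> e/3"
          using dr[of "R y"] R_lip[of y0 y] lt y y0 yd R[of y] 3 by (intro seg_near) (auto simp: t_def)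
        moreover have "norm (U (hi t) - U y0) \<le> e/3"
          using hi_range t y0 yd lo_hi[of t] \<open>hi t < y\<close> by (intro lin) auto
        moreover have "U (hi t) = f t"
          using R_eq[of "hi t" t] hi_range lo_hi t by (intro U_hi) auto
        ultimately show ?thesis
          using norm_triangle_ineq[of "U y - f t" "U (hi t) - U y0"] by simp
      qed
      then show ?thesis using e by (simp add: dist_norm)
    qed
    then show "\<exists>d>0. \<forall>y\<in>{0..Y}. dist y y0 < d \<longrightarrow> dist (U y) (U y0) < e"
      using d' by blast
  qed
  have R_cont: "continuous_on {0..Y} R"
  proof (rule continuous_on_iff[THEN iffD2], intro ballI allI impI)
    fix y0 e :: real assume y0: "y0 \<in> {0..Y}" and e: "0 < e"
    have "dist (R y) (R y0) < e" if "y \<in> {0..Y}" "dist y y0 < e" for y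
      using R_lip[of y y0] R_lip[of y0 y] R_mono[of y y0] R_mono[of y0 y] that y0
      by (cases "y \<le> y0") (auto simp: dist_real_def)
    then show "\<exists>d>0. \<forall>y\<in>{0..Y}. dist y y0 < d \<longrightarrow> dist (R y) (R y0) < e"
      using e by blast
  qed
  have scale: "(\<lambda>s. Y * s) ` {0..1} = {0..Y}"
    using Y image_mult_atLeastAtMost[of Y 0 1] by simp
  have cont: "continuous_on {0..1} (\<lambda>s. (R (Y * s), U (Y * s)))"
    by (intro continuous_on_Pair continuous_on_compose2[OF R_cont] continuous_on_compose2[OF U_cont]
        continuous_intros) (use scale in auto)
  have img: "(\<lambda>y. (R y, U y)) ` {0..Y} = extended_graph T f"
  proof (intro equalityI subsetI)
    fix p assume "p \<in> (\<lambda>y. (R y, U y)) ` {0..Y}"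
    then show "p \<in> extended_graph T f"
      using R U_seg by (auto simp: extended_graph_def)
  next
    fix p assume "p \<in> extended_graph T f"
    then obtain t \<alpha> where t: "t \<in> {0..T}" "0 \<le> \<alpha>" "\<alpha> \<le> 1" "p = (t, (1 - \<alpha>) *\<^sub>R left_lim f t + \<alpha> *\<^sub>R f t)"
      by (auto simp: extended_graph_def closed_segment_def)
    define y where "y = lo t + \<alpha> * (hi t - lo t)"
    have "0 * (hi t - lo t) \<le> \<alpha> * (hi t - lo t)" "\<alpha> * (hi t - lo t) \<le> 1 * (hi t - lo t)"
      by (rule mult_right_mono; use t lo_hi[of t] in simp)+
    then have y: "lo t \<le> y" "y \<le> hi t" by (auto simp: y_def)
    have "0 \<le> lo t" using hi_lo[of 0 t] zero t by (cases "t = 0") auto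
    have "hi t \<le> Y" using hi_lo[of t T] lo_hi[of T] t by (cases "t = T") (auto simp: Y_def)
    have Ry: "R y = t" using R_eq y \<open>0 \<le> lo t\<close> \<open>hi t \<le> Y\<close> by auto
    have "U y = (1 - \<alpha>) *\<^sub>R left_lim f t + \<alpha> *\<^sub>R f t"
    proof (cases "left_lim f t = f t")
      case True
      then show ?thesis using Ry by (simp add: U_def slope_def algebra_simps)
    next
      case False
      then have "\<alpha> = (y - lo t) / (hi t - lo t)" using jump[of t] t by (simp add: y_def)
      then show ?thesis using U_alt[of t y \<alpha>] Ry by simp
    qed
    then show "p \<in> (\<lambda>y. (R y, U y)) ` {0..Y}"
      using t Ry y \<open>0 \<le> lo t\<close> \<open>hi t \<le> Y\<close> by (intro image_eqI[of _ _ y]) auto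
  qed
  have "(\<lambda>s. (R (Y * s), U (Y * s))) ` {0..1} = (\<lambda>y. (R y, U y)) ` ((\<lambda>s. Y * s) ` {0..1})"
    by (simp add: image_image)
  then have surj: "(\<lambda>s. (R (Y * s), U (Y * s))) ` {0..1} = extended_graph T f"
    unfolding scale img .
  have mono: "graph_le f (R y, U y) (R y', U y')" if y: "0 \<le> y" "y \<le> y'" "y' \<le> Y" for y y'
  proof (cases "R y = R y'")
    case True
    have "left_lim f (R y) - U z = - ((z - lo (R y)) *\<^sub>R slope (R y))" if "R z = R y" for z
      using that by (simp add: U_def)
    then show ?thesis
      using True R(2)[of y] R(2)[of y'] y by (auto simp: graph_le_def intro!: mult_right_mono)
  next
    case False
    then show ?thesis using R_mono[OF y] by (simp add: graph_le_def)
  qed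
  have "R 0 = 0" "R Y = T" using R_eq[of 0 0] R_eq[of Y T] zero Y lo_hi[of T] by (auto simp: Y_def)
  then have "U 0 = f 0" "U Y = f T" using U_lo[of 0 0] U_hi[of Y T] zero T by (auto simp: Y_def)
  then have "(\<lambda>s. R (Y * s), \<lambda>s. U (Y * s)) \<in> param_reps T f"
    using cont surj mono Y \<open>R 0 = 0\<close> \<open>R Y = T\<close>
    by (auto simp: param_reps_def intro!: mono mult_left_le mult_left_mono)
  then show ?thesis by blast
qed

section \<open>Polygonal approximation\<close>

text \<open>
  By uniform continuity, extending the interval by a short piece raises the maximum by little.
\<close>

lemma continuous_running_max:
  fixes \<phi> :: "real \<Rightarrow> real"
  assumes \<phi>: "continuous_on {a..b} \<phi>" and ab: "a \<le> b"
  shows "continuous_on {a..b} (\<lambda>s. SUP x\<in>{a..s}. \<phi> x)"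
proof (rule continuous_on_iff[THEN iffD2], intro ballI allI impI)
  fix s0 e :: real assume s0: "s0 \<in> {a..b}" and e: "0 < e"
  let ?m = "\<lambda>s. SUP x\<in>{a..s}. \<phi> x"
  obtain d where d: "0 < d" "\<And>x y. x \<in> {a..b} \<Longrightarrow> y \<in> {a..b} \<Longrightarrow> dist y x < d \<Longrightarrow> dist (\<phi> y) (\<phi> x) < e/2"
    using compact_uniformly_continuous[OF \<phi> compact_Icc] e half_gt_zero[OF e]
    unfolding uniformly_continuous_on_def by metis
  have bdd: "bdd_above (\<phi> ` {a..s})" if "s \<le> b" for s
    using that by (intro bounded_imp_bdd_above compact_imp_bounded compact_continuous_image
        continuous_on_subset[OF \<phi>]) auto
  have le: "?m s \<le> ?m s'" if "a \<le> s" "s \<le> s'" "s' \<le> b" for s s'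
    using that bdd by (intro cSUP_subset_mono) auto
  have ge: "?m s' \<le> ?m s + e/2" if s: "a \<le> s" "s \<le> s'" "s' \<le> b" "s' - s < d" for s s'
  proof (rule cSUP_least)
    fix x assume x: "x \<in> {a..s'}"
    have up: "\<phi> z \<le> ?m s" if "z \<in> {a..s}" for z
      using that s bdd[of s] by (intro cSUP_upper) auto
    show "\<phi> x \<le> ?m s + e/2"
    proof (cases "x \<le> s")
      case True
      then show ?thesis using up[of x] x e by simp
    next
      case False
      then have "dist (\<phi> x) (\<phi> s) < e/2" using d(2)[of s x] x s by (auto simp: dist_real_def)
      then have "\<phi> x \<le> \<phi> s + e/2" unfolding dist_real_def by linarith
      moreover have "\<phi> s \<le> ?m s" using up[of s] s by simp
      ultimately show ?thesis by linarith
    qed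
  qed (use s in auto)
  have "dist (?m s) (?m s0) < e" if s: "s \<in> {a..b}" "dist s s0 < d" for s
  proof (cases "s \<le> s0")
    case True
    then show ?thesis using le[of s s0] ge[of s s0] s s0 e by (auto simp: dist_real_def)
  next
    case False
    then show ?thesis using le[of s0 s] ge[of s0 s] s s0 e by (auto simp: dist_real_def)
  qed
  then show "\<exists>d>0. \<forall>s\<in>{a..b}. dist s s0 < d \<longrightarrow> dist (?m s) (?m s0) < e"
    using d(1) by blast
qed

text \<open>
  The clock is the largest distance from \<open>u a\<close> reached so far, divided by the length
  \<open>D\<close> of the chord and cut off at \<open>1\<close>. As \<open>u\<close> hardly turns
  back, this maximum exceeds the present distance by at most \<open>e\<close>, and the present
  distance differs by at most \<open>e\<close> from the position along the chord of a point within
  \<open>e\<close> of \<open>u s\<close>. If \<open>D = 0\<close>, any clock will do. Outside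
  \<open>[a,b]\<close> the clock is constant, so that clocks of successive cells can be added up.
\<close>

lemma curve_near_segment:
  fixes u :: "real \<Rightarrow> 'v::real_normed_vector"
  assumes ab: "a < b" and u: "continuous_on {a..b} u"
    and near: "\<And>s. a \<le> s \<Longrightarrow> s \<le> b \<Longrightarrow> seg_dist (u a) (u s) (u b) \<le> e"
    and away: "\<And>s s'. a \<le> s' \<Longrightarrow> s' \<le> s \<Longrightarrow> s \<le> b \<Longrightarrow> norm (u s' - u a) \<le> norm (u s - u a) + e"
  obtains l where "continuous_on UNIV l" "mono l" "\<And>s. s \<le> a \<Longrightarrow> l s = 0" "\<And>s. b \<le> s \<Longrightarrow> l s = (1::real)"
    "\<And>s. a \<le> s \<Longrightarrow> s \<le> b \<Longrightarrow> norm (u s - (u a + l s *\<^sub>R (u b - u a))) \<le> 3 * e"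
proof -
  define D where "D = norm (u b - u a)"
  have e: "0 \<le> e" using near[of a] ab by simp
  have "\<exists>k. continuous_on {a..b} k \<and> mono_on {a..b} k \<and> k a = 0 \<and> k b = (1::real) \<and>
          (\<forall>s. a \<le> s \<and> s \<le> b \<longrightarrow> norm (u s - (u a + k s *\<^sub>R (u b - u a))) \<le> 3 * e)"
  proof (cases "D = 0")
    case True
    then have "u b = u a" by (simp add: D_def)
    have "norm (u s - u a) \<le> e" if "a \<le> s" "s \<le> b" for s
      using near[OF that] by (auto simp: seg_dist_le_iff \<open>u b = u a\<close>)
    then have "norm (u s - (u a + ((s - a) / (b - a)) *\<^sub>R (u b - u a))) \<le> 3 * e" if "a \<le> s" "s \<le> b" for s
      using that e \<open>u b = u a\<close> by fastforce
    then show ?thesis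
      using ab by (intro exI[of _ "\<lambda>s. (s - a) / (b - a)"])
        (auto intro!: continuous_intros mono_onI divide_right_mono)
  next
    case False
    then have D: "0 < D" by (simp add: D_def)
    let ?\<phi> = "\<lambda>s. norm (u s - u a)"
    define m where "m s = (SUP x\<in>{a..s}. ?\<phi> x)" for s
    have \<phi>: "continuous_on {a..b} ?\<phi>" by (intro continuous_intros u)
    have bdd: "bdd_above (?\<phi> ` {a..s})" if "s \<le> b" for s
      using that by (intro bounded_imp_bdd_above compact_imp_bounded compact_continuous_image
          continuous_on_subset[OF \<phi>]) auto
    have m_cont: "continuous_on {a..b} m"
      unfolding m_def using continuous_running_max[OF \<phi>] ab by simp
    have m_mono: "m s \<le> m s'" if "a \<le> s" "s \<le> s'" "s' \<le> b" for s s'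
      unfolding m_def using that bdd by (intro cSUP_subset_mono) auto
    have m_ge: "?\<phi> s \<le> m s" if "a \<le> s" "s \<le> b" for s
      unfolding m_def using that bdd by (intro cSUP_upper) auto
    have m_le: "m s \<le> ?\<phi> s + e" if "a \<le> s" "s \<le> b" for s
      unfolding m_def using that away by (intro cSUP_least) auto
    define k where "k s = min 1 (m s / D)" for s
    have "m a = 0" by (simp add: m_def)
    then have ka: "k a = 0" by (simp add: k_def)
    have kb: "k b = 1" using m_ge[of b] D ab by (simp add: k_def D_def)
    have k_cont: "continuous_on {a..b} k"
      unfolding k_def using D by (intro continuous_intros m_cont) auto
    have k_mono: "mono_on {a..b} k"
    proof (rule mono_onI)
      fix s t assume "s \<in> {a..b}" "t \<in> {a..b}" "s \<le> t"
      then have "m s / D \<le> m t / D" using m_mono D by (intro divide_right_mono) auto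
      then show "k s \<le> k t" by (simp add: k_def min_le_iff_disj)
    qed
    have "norm (u s - (u a + k s *\<^sub>R (u b - u a))) \<le> 3 * e" if s: "a \<le> s" "s \<le> b" for s
    proof -
      obtain p where "p \<in> closed_segment (u a) (u b)" and p: "norm (u s - p) \<le> e"
        using near[OF s] by (auto simp: seg_dist_le_iff)
      then obtain \<alpha> where \<alpha>: "0 \<le> \<alpha>" "\<alpha> \<le> 1" "p = u a + \<alpha> *\<^sub>R (u b - u a)"
        by (auto simp: closed_segment_def algebra_simps)
      have "norm (p - u a) = \<alpha> * D" using \<alpha> by (simp add: D_def)
      then have "\<bar>?\<phi> s - \<alpha> * D\<bar> \<le> e"
        using norm_triangle_ineq3[of "u s - u a" "p - u a"] p by simp
      moreover have "k s * D = min D (m s)"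
        using D by (simp add: k_def min_def field_simps)
      moreover have "\<alpha> * D \<le> D" using \<alpha> D by simp
      ultimately have "\<bar>\<alpha> * D - k s * D\<bar> \<le> 2 * e"
        using m_ge[OF s] m_le[OF s] e by (auto simp: min_def abs_le_iff)
      moreover have "norm ((\<alpha> - k s) *\<^sub>R (u b - u a)) = \<bar>\<alpha> * D - k s * D\<bar>"
        using D by (simp add: D_def[symmetric] abs_mult left_diff_distrib[symmetric])
      moreover have eq: "u s - (u a + k s *\<^sub>R (u b - u a)) = (u s - p) + (\<alpha> - k s) *\<^sub>R (u b - u a)"
        by (simp add: \<alpha>(3) algebra_simps)
      ultimately show ?thesis
        unfolding eq using norm_triangle_ineq[of "u s - p" "(\<alpha> - k s) *\<^sub>R (u b - u a)"] p by linarith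
    qed
    then show ?thesis using k_cont k_mono ka kb by blast
  qed
  then obtain k where k: "continuous_on {a..b} k" "mono_on {a..b} k" "k a = 0" "k b = (1::real)"
    and k': "\<And>s. a \<le> s \<Longrightarrow> s \<le> b \<Longrightarrow> norm (u s - (u a + k s *\<^sub>R (u b - u a))) \<le> 3 * e"
    by blast
  define l where "l s = k (max a (min b s))" for s
  have clamp: "max a (min b s) \<in> {a..b}" for s using ab by auto
  show ?thesis
  proof (rule that)
    show "continuous_on UNIV l"
      unfolding l_def using clamp by (intro continuous_on_compose2[OF k(1)] continuous_intros) auto
    show "mono l"
      unfolding l_def by (intro monoI mono_onD[OF k(2)] clamp) auto
    show "l s = 0" if "s \<le> a" for s using that ab k by (simp add: l_def)
    show "l s = 1" if "b \<le> s" for s using that ab k by (simp add: l_def)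
    show "norm (u s - (u a + l s *\<^sub>R (u b - u a))) \<le> 3 * e" if "a \<le> s" "s \<le> b" for s
      using k'[OF that] that by (simp add: l_def)
  qed
qed

definition grid :: "real \<Rightarrow> nat \<Rightarrow> nat \<Rightarrow> real" where
  "grid T n i = real i * T / real n"

definition polygon :: "real \<Rightarrow> nat \<Rightarrow> (nat \<Rightarrow> 'v::real_normed_vector) \<Rightarrow> real \<Rightarrow> 'v" where
  "polygon T n x t = interp n x (t * real n / T)"

lemma grid_range: "0 < T \<Longrightarrow> i \<le> n \<Longrightarrow> grid T n i \<in> {0..T}"
  by (cases "n = 0") (auto simp: grid_def divide_simps mult.commute)

lemma continuous_polygon: "continuous_on A (polygon T n x)"
  unfolding polygon_def
  by (rule continuous_on_compose2[OF continuous_interp[of UNIV]]) (auto intro!: continuous_intros simp: divide_inverse)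

lemma param_reps_polygon:
  assumes T: "0 < T" and r: "continuous_on {0..1} r" "mono_on {0..1} r" "r 0 = 0" "r 1 = T"
  shows "(r, \<lambda>s. polygon T n x (r s)) \<in> param_reps T (polygon T n x)"
  using param_reps_continuous_fun[OF continuous_polygon T r] .

lemma param_reps_polygon_nonempty:
  assumes "0 < T" shows "param_reps T (polygon T n x) \<noteq> {}"
proof -
  have "(\<lambda>s. T * s, \<lambda>s. polygon T n x (T * s)) \<in> param_reps T (polygon T n x)"
    using assms by (intro param_reps_polygon) (auto intro!: continuous_intros mono_onI)
  then show ?thesis by blast
qed

text \<open>Both polygons are continuous, so they may be parametrised by the same linear time change.\<close>

lemma dist_M1_polygon_le:
  assumes T: "0 < T" and n: "0 < n" and xy: "\<And>i. i \<le> n \<Longrightarrow> norm (x i - y i) \<le> e"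
  shows "dist_M1 T (polygon T n x) (polygon T n y) \<le> e"
proof (rule dist_M1_leI)
  have r: "continuous_on {0..1} (\<lambda>s. T * s)" "mono_on {0..1} (\<lambda>s. T * s)" "T * 0 = 0" "T * 1 = T"
    using T by (auto intro!: continuous_intros mono_onI)
  show "(\<lambda>s. T * s, \<lambda>s. polygon T n x (T * s)) \<in> param_reps T (polygon T n x)"
    "(\<lambda>s. T * s, \<lambda>s. polygon T n y (T * s)) \<in> param_reps T (polygon T n y)"
    by (rule param_reps_polygon[OF T r])+
  fix s :: real assume s: "0 \<le> s" "s \<le> 1"
  have "0 \<le> e" using xy[of 0] norm_ge_zero order_trans by blast
  moreover have "norm (polygon T n x (T * s) - polygon T n y (T * s)) \<le> e"
    unfolding polygon_def using s T n xy by (intro interp_diff_le) (auto intro: mult_left_le_one_le)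
  ultimately show "\<bar>T * s - T * s\<bar> \<le> e \<and> norm (polygon T n x (T * s) - polygon T n y (T * s)) \<le> e"
    by simp
qed

text \<open>
  The representation of \<open>f\<close> is kept, and the polygon is given a time change
  \<open>\<rho>\<close> that is synchronised with it at the grid points and follows the clock of the
  chord within each cell.
\<close>

lemma dist_M1_polygon_approx:
  fixes f :: "real \<Rightarrow> 'v::real_normed_vector"
  assumes f: "cadlag_on T f" and T: "0 < T" and n: "0 < n" and \<delta>: "T / real n < \<delta>"
  shows "dist_M1 T f (polygon T n (\<lambda>i. f (grid T n i))) \<le> T / real n + 27 * osc_M1 T f \<delta>"
proof -
  let ?g = "polygon T n (\<lambda>i. f (grid T n i))"
  define m where "m = osc_M1 T f \<delta>"
  define h where "h = T / real n"
  have h: "0 < h" "h < \<delta>" using T n \<delta> by (auto simp: h_def)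
  have grid: "grid T n i = real i * h" for i by (simp add: grid_def h_def)
  have m: "0 \<le> m" using osc_M1_nonneg[OF f T] h by (simp add: m_def)
  obtain r u where ru: "(r, u) \<in> param_reps T f"
    using param_reps_nonempty[OF f T] by auto
  have ends: "r 0 = 0" "u 0 = f 0" "r 1 = T" "u 1 = f T" using ru by (auto simp: param_reps_def)
  \<comment> \<open>Times at which the representation passes through the grid points. It may rest at the first and at
    the last one, so these two times are prescribed.\<close>
  have "\<exists>s. 0 \<le> s \<and> s \<le> 1 \<and> r s = grid T n i \<and> u s = f (grid T n i)
      \<and> (i = 0 \<longrightarrow> s = 0) \<and> (i = n \<longrightarrow> s = 1)" if i: "i \<le> n" for i
  proof -
    consider "i = 0" | "i = n" | "i \<noteq> 0" "i \<noteq> n" by blast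
    then show ?thesis
    proof cases
      case 1
      then show ?thesis using ends n by (intro exI[of _ 0]) (auto simp: grid_def)
    next
      case 2
      then show ?thesis using ends n by (intro exI[of _ 1]) (auto simp: grid_def)
    next
      case 3
      obtain s where "0 \<le> s" "s \<le> 1" "(r s, u s) = (grid T n i, f (grid T n i))"
        using param_reps_surj[OF ru graph_in_extended_graph[OF grid_range[OF T i]]] by blast
      then show ?thesis using 3 by auto
    qed
  qed
  then obtain c where c: "\<And>i. i \<le> n \<Longrightarrow> 0 \<le> c i \<and> c i \<le> 1 \<and> r (c i) = grid T n i \<and> u (c i) = f (grid T n i)
      \<and> (i = 0 \<longrightarrow> c i = 0) \<and> (i = n \<longrightarrow> c i = 1)"
    by metis
  have c_less: "c i < c j" if "i < j" "j \<le> n" for i j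
  proof (rule ccontr)
    assume "\<not> c i < c j"
    then have "r (c j) \<le> r (c i)" using c[of i] c[of j] that by (intro param_reps_mono[OF ru]) auto
    then show False using c[of i] c[of j] that h by (simp add: grid)
  qed
  have c_le: "c i \<le> c j" if "i \<le> j" "j \<le> n" for i j
    using c_less[of i j] that by (cases "i = j") auto
  define cell_clock where "cell_clock i l \<longleftrightarrow> continuous_on UNIV l \<and> mono l \<and> (\<forall>s\<le>c i. l s = 0) \<and> (\<forall>s\<ge>c (Suc i). l s = (1::real)) \<and>
      (\<forall>s. c i \<le> s \<and> s \<le> c (Suc i) \<longrightarrow>
        norm (u s - (f (grid T n i) + l s *\<^sub>R (f (grid T n (Suc i)) - f (grid T n i)))) \<le> 27 * m)" for i l
  have cell: "\<exists>l. cell_clock i l" if i: "i < n" for i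
  proof -
    have ci: "0 \<le> c i" "c (Suc i) \<le> 1" "c i < c (Suc i)"
      "r (c i) = grid T n i" "r (c (Suc i)) = grid T n (Suc i)"
      "u (c i) = f (grid T n i)" "u (c (Suc i)) = f (grid T n (Suc i))"
      using c[of i] c[of "Suc i"] c_less[of i "Suc i"] i by auto
    have near: "seg_dist (u s1) (u s) (u s2) \<le> 9 * m"
      if s: "c i \<le> s1" "s1 \<le> s" "s \<le> s2" "s2 \<le> c (Suc i)" for s1 s s2
      unfolding m_def
    proof (rule seg_dist_extended_graph[OF f T])
      show "0 < \<delta>" using h by simp
      have "r (c i) \<le> r s1" "r s2 \<le> r (c (Suc i))"
        using ci s param_reps_mono(2)[OF ru, of "c i" s1] param_reps_mono(2)[OF ru, of s2 "c (Suc i)"] by auto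
      then show "r s2 - r s1 < \<delta>" using ci h by (simp add: grid algebra_simps)
    qed (use s ci in \<open>auto intro!: param_reps_mono[OF ru] param_reps_mem[OF ru]\<close>)
    have away: "norm (u s' - u (c i)) \<le> norm (u s - u (c i)) + 9 * m"
      if s: "c i \<le> s'" "s' \<le> s" "s \<le> c (Suc i)" for s s'
    proof -
      obtain p where p: "p \<in> closed_segment (u (c i)) (u s)" "norm (u s' - p) \<le> 9 * m"
        using near[of "c i" s' s] s by (auto simp: seg_dist_le_iff)
      have "norm (p - u (c i)) \<le> norm (u s - u (c i))"
        using segment_bound[OF p(1)] by simp
      then show ?thesis
        using norm_triangle_ineq[of "u s' - p" "p - u (c i)"] p(2) by simp
    qed
    have cont: "continuous_on {c i..c (Suc i)} u"
      using ci by (intro continuous_on_subset[OF param_reps_continuous(3)[OF ru]]) auto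
    obtain l where "continuous_on UNIV l" "mono l" "\<And>s. s \<le> c i \<Longrightarrow> l s = 0"
      "\<And>s. c (Suc i) \<le> s \<Longrightarrow> l s = (1::real)"
      "\<And>s. c i \<le> s \<Longrightarrow> s \<le> c (Suc i) \<Longrightarrow>
        norm (u s - (u (c i) + l s *\<^sub>R (u (c (Suc i)) - u (c i)))) \<le> 3 * (9 * m)"
      by (rule curve_near_segment[OF ci(3) cont, of "9 * m"]) (use near ci(3) away in auto)
    then show ?thesis using ci unfolding cell_clock_def by (intro exI[of _ l]) auto
  qed
  have "\<forall>i. \<exists>l. i < n \<longrightarrow> cell_clock i l" using cell by blast
  then obtain l where cc: "\<And>i. i < n \<Longrightarrow> cell_clock i (l i)" unfolding choice_iff by blast
  have l: "\<And>i. i < n \<Longrightarrow> continuous_on UNIV (l i)" "\<And>i. i < n \<Longrightarrow> mono (l i)"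
    "\<And>i s. i < n \<Longrightarrow> s \<le> c i \<Longrightarrow> l i s = 0" "\<And>i s. i < n \<Longrightarrow> c (Suc i) \<le> s \<Longrightarrow> l i s = (1::real)"
    "\<And>i s. i < n \<Longrightarrow> c i \<le> s \<Longrightarrow> s \<le> c (Suc i) \<Longrightarrow>
        norm (u s - (f (grid T n i) + l i s *\<^sub>R (f (grid T n (Suc i)) - f (grid T n i)))) \<le> 27 * m"
    using cc unfolding cell_clock_def by blast+
  define \<rho> where "\<rho> s = (\<Sum>i<n. l i s *\<^sub>R h)" for s
  have \<rho>_cont: "continuous_on {0..1} \<rho>"
    unfolding \<rho>_def by (intro continuous_intros continuous_on_subset[OF l(1)]) auto
  have \<rho>_mono: "mono_on {0..1} \<rho>"
    unfolding \<rho>_def using h by (auto intro!: mono_onI sum_mono mult_right_mono monoD[OF l(2)])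
  have \<rho>_cell: "\<rho> s = (real j + l j s) * h" "0 \<le> l j s" "l j s \<le> 1"
    if j: "j < n" "c j \<le> s" "s \<le> c (Suc j)" for j s
  proof -
    have "\<rho> s = (\<Sum>i<j. h) + l j s *\<^sub>R h"
      unfolding \<rho>_def
    proof (rule sum_staircase[OF j(1)])
      show "l i s = 1" if "i < j" for i
        using that j c_le[of "Suc i" j] by (intro l(4)) auto
      show "l i s = 0" if "j < i" "i < n" for i
        using that j c_le[of "Suc j" i] by (intro l(3)) auto
    qed
    then show "\<rho> s = (real j + l j s) * h" by (simp add: algebra_simps)
    show "0 \<le> l j s" "l j s \<le> 1"
      using monoD[OF l(2)[OF j(1)] j(2)] monoD[OF l(2)[OF j(1)] j(3)] l(3)[OF j(1), of "c j"]
        l(4)[OF j(1), of "c (Suc j)"] by auto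
  qed
  have nn: "n - 1 < n" "Suc (n - 1) = n" using n by auto
  have \<rho>0: "\<rho> 0 = 0"
    using \<rho>_cell(1)[of 0 0] c[of 0] c_le[of 0 1] l(3)[of 0 0] n by auto
  have \<rho>1: "\<rho> 1 = T"
    using \<rho>_cell(1)[of "n - 1" 1] c[of n] c[of "n - 1"] l(4)[of "n - 1" 1] nn n
    by (auto simp: h_def of_nat_diff)
  show ?thesis
  proof (rule dist_M1_leI[OF ru param_reps_polygon[OF T \<rho>_cont \<rho>_mono \<rho>0 \<rho>1]])
    fix s :: real assume s: "0 \<le> s" "s \<le> 1"
    obtain j where j: "j < n" "c j \<le> s" "s \<le> c (Suc j)"
      using partition_cell[OF n, of c s] c[of 0] c[of n] s by auto
    have "r (c j) \<le> r s" "r s \<le> r (c (Suc j))"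
      using j s c[of j] c[of "Suc j"] param_reps_mono(2)[OF ru, of "c j" s]
        param_reps_mono(2)[OF ru, of s "c (Suc j)"] by auto
    then have r: "real j * h \<le> r s" "r s \<le> real (Suc j) * h"
      using c[of j] c[of "Suc j"] j by (auto simp: grid)
    have "0 * h \<le> l j s * h" "l j s * h \<le> 1 * h"
      by (rule mult_right_mono; use \<rho>_cell(2,3)[OF j] h in simp)+
    then have "\<bar>r s - \<rho> s\<bar> \<le> h"
      using r by (simp add: \<rho>_cell(1)[OF j] algebra_simps abs_le_iff)
    moreover have "?g (\<rho> s) = f (grid T n j) + l j s *\<^sub>R (f (grid T n (Suc j)) - f (grid T n j))"
    proof -
      have "\<rho> s * real n / T = real j + l j s"
        unfolding \<rho>_cell(1)[OF j] h_def using T n by simp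
      then show ?thesis
        unfolding polygon_def using interp_cell[OF j(1), of "real j + l j s"] \<rho>_cell(2,3)[OF j] by simp
    qed
    then have "norm (u s - ?g (\<rho> s)) \<le> 27 * m"
      using l(5)[OF j] by simp
    ultimately show "\<bar>r s - \<rho> s\<bar> \<le> T / real n + 27 * osc_M1 T f \<delta> \<and>
        norm (u s - ?g (\<rho> s)) \<le> T / real n + 27 * osc_M1 T f \<delta>"
      using m h by (simp add: m_def h_def)
  qed
qed

lemma dist_M1_le_grid:
  fixes f g :: "real \<Rightarrow> 'v::real_normed_vector"
  assumes f: "cadlag_on T f" and g: "cadlag_on T g" and T: "0 < T" and n: "0 < n" and \<delta>: "T / real n < \<delta>"
    and fg: "\<And>i. i \<le> n \<Longrightarrow> norm (f (grid T n i) - g (grid T n i)) \<le> e"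
  shows "dist_M1 T f g \<le> 2 * (T / real n) + 27 * osc_M1 T f \<delta> + 27 * osc_M1 T g \<delta> + e"
proof -
  let ?f = "polygon T n (\<lambda>i. f (grid T n i))" and ?g = "polygon T n (\<lambda>i. g (grid T n i))"
  note ne = param_reps_nonempty[OF f T] param_reps_nonempty[OF g T] param_reps_polygon_nonempty[OF T]
  have "dist_M1 T f g \<le> dist_M1 T f ?f + (dist_M1 T ?f ?g + dist_M1 T ?g g)"
    using dist_M1_triangle[OF T ne(1) ne(3) ne(2)] dist_M1_triangle[OF T ne(3) ne(3) ne(2)] add_left_mono order_trans
    by meson
  then show ?thesis
    using dist_M1_polygon_approx[OF f T n \<delta>] dist_M1_polygon_approx[OF g T n \<delta>]
      dist_M1_polygon_le[OF T n, of "\<lambda>i. f (grid T n i)" "\<lambda>i. g (grid T n i)" e] fg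
    by (simp add: dist_M1_commute[of T ?g g])
qed

text \<open>
  This expresses the distance by countably many values of the two functions, as needed for its
  measurability.
\<close>

lemma dist_M1_polygon_tendsto:
  fixes f g :: "real \<Rightarrow> 'v::real_normed_vector"
  assumes f: "cadlag_on T f" and g: "cadlag_on T g" and T: "0 < T"
  shows "(\<lambda>n. dist_M1 T (polygon T (Suc n) (\<lambda>i. f (grid T (Suc n) i)))
                        (polygon T (Suc n) (\<lambda>i. g (grid T (Suc n) i)))) \<longlonglongrightarrow> dist_M1 T f g"
proof -
  define p where "p h n = polygon T (Suc n) (\<lambda>i. h (grid T (Suc n) i))" for h :: "real \<Rightarrow> 'v" and n
  define \<delta> where "\<delta> n = 2 * (T / real (Suc n))" for n
  define E where "E n = 2 * (T / real (Suc n)) + 27 * osc_M1 T f (\<delta> n) + 27 * osc_M1 T g (\<delta> n)" for n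
  have \<delta>: "0 < \<delta> n" "T / real (Suc n) < \<delta> n" for n
  proof -
    have "0 < T / real (Suc n)" using T by simp
    then show "0 < \<delta> n" "T / real (Suc n) < \<delta> n" unfolding \<delta>_def by linarith+
  qed
  have \<delta>0: "\<delta> \<longlonglongrightarrow> 0"
    unfolding \<delta>_def using tendsto_mult_right_zero[OF LIMSEQ_Suc[OF lim_const_over_n[of T]], of 2] by simp
  have "filterlim \<delta> (at_right 0) sequentially"
    using \<delta>0 \<delta>(1) by (intro tendsto_imp_filterlim_at_right always_eventually) auto
  then have "(\<lambda>n. osc_M1 T h (\<delta> n)) \<longlonglongrightarrow> 0" if "cadlag_on T h" for h :: "real \<Rightarrow> 'v"
    by (rule filterlim_compose[OF osc_M1_tendsto_0[OF that T]])
  then have "(\<lambda>n. \<delta> n + 27 * osc_M1 T f (\<delta> n) + 27 * osc_M1 T g (\<delta> n)) \<longlonglongrightarrow> 0 + 27 * 0 + 27 * 0"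
    using f g \<delta>0 by (intro tendsto_intros) auto
  then have E0: "E \<longlonglongrightarrow> 0" by (simp add: E_def[abs_def] \<delta>_def)
  note ne = param_reps_nonempty[OF f T] param_reps_nonempty[OF g T]
  have ne': "param_reps T (p h n) \<noteq> {}" for h n
    unfolding p_def by (rule param_reps_polygon_nonempty[OF T])
  have "norm (dist_M1 T (p f n) (p g n) - dist_M1 T f g) \<le> E n" for n
  proof -
    have "dist_M1 T f (p f n) \<le> T / real (Suc n) + 27 * osc_M1 T f (\<delta> n)"
      "dist_M1 T g (p g n) \<le> T / real (Suc n) + 27 * osc_M1 T g (\<delta> n)"
      unfolding p_def by (intro dist_M1_polygon_approx f g T \<delta>(2); simp)+
    moreover have "dist_M1 T f g \<le> dist_M1 T f (p f n) + dist_M1 T (p f n) g"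
      "dist_M1 T (p f n) g \<le> dist_M1 T (p f n) (p g n) + dist_M1 T (p g n) g"
      "dist_M1 T (p f n) (p g n) \<le> dist_M1 T (p f n) f + dist_M1 T f (p g n)"
      "dist_M1 T f (p g n) \<le> dist_M1 T f g + dist_M1 T g (p g n)"
      by (intro dist_M1_triangle T ne ne')+
    ultimately show ?thesis
      unfolding E_def using dist_M1_commute[of T "p g n" g] dist_M1_commute[of T "p f n" f]
      by (simp add: abs_le_iff)
  qed
  then have "(\<lambda>n. dist_M1 T (p f n) (p g n) - dist_M1 T f g) \<longlonglongrightarrow> 0"
    by - (rule Lim_null_comparison[OF always_eventually E0], auto)
  then show ?thesis
    unfolding p_def by (rule LIM_zero_cancel)
qed

section \<open>What closeness says about values and oscillation\<close>

text \<open>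
  A triple of values of \<open>g\<close> is matched, at the cost of \<open>\<eta>\<close> for each of
  its points, with a triple of the extended graph of \<open>f\<close> in the same order. Its times
  move by less than \<open>\<eta>\<close>, which widens the window by less than
  \<open>2\<eta>\<close>.
\<close>

lemma osc_M1_le_if_dist_M1_less:
  fixes f g :: "real \<Rightarrow> 'v::real_normed_vector"
  assumes f: "cadlag_on T f" and g: "cadlag_on T g" and T: "0 < T" and \<delta>: "0 < \<delta>"
    and less: "dist_M1 T g f < \<eta>" and \<delta>': "\<delta> + 2 * \<eta> \<le> \<delta>'"
  shows "osc_M1 T g \<delta> \<le> 3 * \<eta> + 9 * osc_M1 T f \<delta>'"
proof (rule osc_M1_leI[OF T \<delta>])
  obtain r u r' u' where A: "(r, u) \<in> param_reps T g" "(r', u') \<in> param_reps T f"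
    and close: "\<And>s. 0 \<le> s \<Longrightarrow> s \<le> 1 \<Longrightarrow> \<bar>r s - r' s\<bar> < \<eta> \<and> norm (u s - u' s) < \<eta>"
    by (rule dist_M1_lessE[OF less param_reps_nonempty[OF g T] param_reps_nonempty[OF f T]]) blast
  fix t1 t t2 :: real assume t: "0 \<le> t1" "t1 < t" "t < t2" "t2 \<le> T" "t2 - t1 \<le> \<delta>"
  have pt: "\<exists>s. 0 \<le> s \<and> s \<le> 1 \<and> r s = x \<and> u s = g x" if "x \<in> {0..T}" for x
    using param_reps_surj[OF A(1) graph_in_extended_graph[OF that]] by (metis prod.inject)
  obtain s1 where s1: "0 \<le> s1" "s1 \<le> 1" "r s1 = t1" "u s1 = g t1" using pt[of t1] t by auto
  obtain s where s: "0 \<le> s" "s \<le> 1" "r s = t" "u s = g t" using pt[of t] t by auto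
  obtain s2 where s2: "0 \<le> s2" "s2 \<le> 1" "r s2 = t2" "u s2 = g t2" using pt[of t2] t by auto
  have "s1 \<le> s" "s \<le> s2"
    using param_reps_mono(2)[OF A(1), of s s1] param_reps_mono(2)[OF A(1), of s2 s] s1 s s2 t by force+
  have "seg_dist (u' s1) (u' s) (u' s2) \<le> 9 * osc_M1 T f \<delta>'"
  proof (rule seg_dist_extended_graph[OF f T])
    have "0 < \<eta>" using close[of 0] by linarith
    then show "0 < \<delta>'" using \<delta> \<delta>' by simp
    show "r' s2 - r' s1 < \<delta>'"
      using close[OF s1(1,2)] close[OF s2(1,2)] s1 s2 t \<delta>' by (auto simp: abs_less_iff)
  qed (use s1 s s2 \<open>s1 \<le> s\<close> \<open>s \<le> s2\<close> in \<open>auto intro!: param_reps_mono[OF A(2)] param_reps_mem[OF A(2)]\<close>)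
  moreover have "seg_dist (g t1) (g t) (g t2) \<le> seg_dist (u' s1) (u' s) (u' s2)
      + norm (g t - u' s) + norm (g t1 - u' s1) + norm (g t2 - u' s2)"
    by (rule seg_dist_perturb)
  ultimately show "seg_dist (g t1) (g t) (g t2) \<le> 3 * \<eta> + 9 * osc_M1 T f \<delta>'"
    using close[OF s1(1,2)] close[OF s2(1,2)] close[OF s(1,2)] s1 s s2 by auto
qed

text \<open>
  The point matched with \<open>(t, g t)\<close> has a time within \<open>\<eta>\<close> of
  \<open>t\<close>, hence between \<open>t1\<close> and \<open>t2\<close>, and so it is close to the
  segment between \<open>f t1\<close> and \<open>f t2\<close>, whose ends are close to \<open>f
  t\<close>. At the borders of \<open>[0,T]\<close> the margin \<open>\<eta>\<close> is replaced by
  the fact that the representations start and end there.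
\<close>

lemma norm_diff_le_if_dist_M1_less:
  fixes f g :: "real \<Rightarrow> 'v::real_normed_vector"
  assumes f: "cadlag_on T f" and g: "cadlag_on T g" and T: "0 < T"
    and t: "0 \<le> t1" "t1 \<le> t" "t \<le> t2" "t2 \<le> T" "t2 - t1 < \<delta>" "0 < \<delta>"
    and less: "dist_M1 T g f < \<eta>"
    and \<eta>: "t1 = 0 \<or> \<eta> \<le> t - t1" "t2 = T \<or> \<eta> \<le> t2 - t"
    and c: "norm (f t1 - f t) \<le> c" "norm (f t2 - f t) \<le> c"
  shows "norm (g t - f t) \<le> \<eta> + 9 * osc_M1 T f \<delta> + c"
proof -
  obtain r u r' u' where A: "(r, u) \<in> param_reps T g" "(r', u') \<in> param_reps T f"
    and close: "\<And>s. 0 \<le> s \<Longrightarrow> s \<le> 1 \<Longrightarrow> \<bar>r s - r' s\<bar> < \<eta> \<and> norm (u s - u' s) < \<eta>"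
    by (rule dist_M1_lessE[OF less param_reps_nonempty[OF g T] param_reps_nonempty[OF f T]]) blast
  have "t \<in> {0..T}" using t by auto
  then obtain s where s: "0 \<le> s" "s \<le> 1" "r s = t" "u s = g t"
    using param_reps_surj[OF A(1) graph_in_extended_graph[of t T g]] by (metis prod.inject)
  have mem: "(r' s, u' s) \<in> extended_graph T f" by (rule param_reps_mem[OF A(2) s(1,2)])
  have "\<exists>s1. 0 \<le> s1 \<and> s1 \<le> s \<and> (r' s1, u' s1) = (t1, f t1)"
  proof (cases "t1 = 0")
    case True
    then show ?thesis using A(2) s by (intro exI[of _ 0]) (auto simp: param_reps_def)
  next
    case False
    obtain s1 where s1: "0 \<le> s1" "s1 \<le> 1" "(r' s1, u' s1) = (t1, f t1)"
      using param_reps_surj[OF A(2) graph_in_extended_graph[of t1 T f]] t by auto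
    then have "s1 \<le> s"
      using param_reps_mono(2)[OF A(2), of s s1] close[OF s(1,2)] s \<eta> False by (force simp: abs_less_iff)
    then show ?thesis using s1 by blast
  qed
  then obtain s1 where s1: "0 \<le> s1" "s1 \<le> s" "r' s1 = t1" "u' s1 = f t1" by auto
  have "\<exists>s2. s \<le> s2 \<and> s2 \<le> 1 \<and> (r' s2, u' s2) = (t2, f t2)"
  proof (cases "t2 = T")
    case True
    then show ?thesis using A(2) s by (intro exI[of _ 1]) (auto simp: param_reps_def)
  next
    case False
    obtain s2 where s2: "0 \<le> s2" "s2 \<le> 1" "(r' s2, u' s2) = (t2, f t2)"
      using param_reps_surj[OF A(2) graph_in_extended_graph[of t2 T f]] t by auto
    then have "s \<le> s2"
      using param_reps_mono(2)[OF A(2), of s2 s] close[OF s(1,2)] s \<eta> False by (force simp: abs_less_iff)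
    then show ?thesis using s2 by blast
  qed
  then obtain s2 where s2: "s \<le> s2" "s2 \<le> 1" "r' s2 = t2" "u' s2 = f t2" by auto
  have "seg_dist (u' s1) (u' s) (u' s2) \<le> 9 * osc_M1 T f \<delta>"
    using s s1 s2 t
    by (intro seg_dist_extended_graph[OF f T, of _ "r' s1" _ "r' s" _ "r' s2"]
        param_reps_mono[OF A(2)] param_reps_mem[OF A(2)]) auto
  then obtain p where p: "p \<in> closed_segment (f t1) (f t2)" "norm (u' s - p) \<le> 9 * osc_M1 T f \<delta>"
    using s1 s2 by (auto simp: seg_dist_le_iff)
  have "closed_segment (f t1) (f t2) \<subseteq> cball (f t) c"
    using c by (intro closed_segment_subset) (auto simp: dist_norm norm_minus_commute)
  then have "norm (p - f t) \<le> c" using p(1) by (auto simp: dist_norm norm_minus_commute)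
  moreover have "norm (g t - f t) \<le> norm (g t - u' s) + norm (u' s - p) + norm (p - f t)"
    using norm_triangle_ineq[of "g t - u' s" "u' s - p"] norm_triangle_ineq[of "g t - p" "p - f t"] by simp
  ultimately show ?thesis using close[OF s(1,2)] s p(2) by simp
qed

section \<open>Measurability\<close>

lemma measurable_seg_dist:
  fixes X Y Z :: "'w \<Rightarrow> 'v::{real_normed_vector, second_countable_topology}"
  assumes "X \<in> borel_measurable M" "Y \<in> borel_measurable M" "Z \<in> borel_measurable M"
  shows "(\<lambda>\<omega>. seg_dist (X \<omega>) (Y \<omega>) (Z \<omega>)) \<in> borel_measurable M"
proof -
  have "continuous_on UNIV (\<lambda>p::'v \<times> 'v \<times> 'v. seg_dist (fst p) (fst (snd p)) (snd (snd p)))"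
    unfolding continuous_on_def
    by (intro ballI tendsto_seg_dist tendsto_fst tendsto_snd tendsto_ident_at)
  then have G: "(\<lambda>p::'v \<times> 'v \<times> 'v. seg_dist (fst p) (fst (snd p)) (snd (snd p))) \<in> borel_measurable borel"
    by (rule borel_measurable_continuous_onI)
  have "(\<lambda>\<omega>. (X \<omega>, Y \<omega>, Z \<omega>)) \<in> borel_measurable M"
    using assms by (intro borel_measurable_Pair)
  from measurable_compose[OF this G] show ?thesis by simp
qed

text \<open>
  Right continuity allows rational times. The time \<open>T\<close> must be kept because nothing lies
  to the right of it. The left end is moved first, by some amount, and then the right end by less,
  so that the window does not become longer than \<open>\<delta>\<close>.
\<close>

lemma osc_M1_countable:
  fixes f :: "real \<Rightarrow> 'v::real_normed_vector"
  assumes f: "cadlag_on T f" and T: "0 < T" and \<delta>: "0 < \<delta>"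
  shows "osc_M1 T f \<delta> = (SUP (t1, t, t2)\<in>osc_triples T \<delta> \<inter> (insert T \<rat>) \<times> (insert T \<rat>) \<times> (insert T \<rat>).
           seg_dist (f t1) (f t) (f t2))" (is "_ = (SUP p\<in>?D. ?G p)")
proof -
  have bdd: "bdd_above (?G ` osc_triples T \<delta>)" using osc_M1_bdd[OF f less_imp_le[OF T]] .
  then have bddD: "bdd_above (?G ` ?D)"
    by (rule bdd_above_mono[OF _ image_mono[OF Int_lower1]])
  have approx: "\<exists>p\<in>?D. seg_dist (f t1) (f t) (f t2) \<le> ?G p + e"
    if t: "0 \<le> t1" "t1 < t" "t < t2" "t2 \<le> T" "t2 - t1 \<le> \<delta>" and e: "0 < e" for t1 t t2 e
  proof -
    have right: "\<exists>d>0. \<forall>s. s \<le> T \<and> a < s \<and> s < a + d \<longrightarrow> norm (f s - f a) \<le> e/3" if "0 \<le> a" "a \<le> T" for a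
      using cadlag_nbhd[OF f that, of "e/3"] e by auto
    obtain d1 where d1: "0 < d1" "\<forall>s. s \<le> T \<and> t1 < s \<and> s < t1 + d1 \<longrightarrow> norm (f s - f t1) \<le> e/3"
      using right[of t1] t by auto
    obtain d where d: "0 < d" "\<forall>s. s \<le> T \<and> t < s \<and> s < t + d \<longrightarrow> norm (f s - f t) \<le> e/3"
      using right[of t] t by auto
    obtain s1 where s1: "s1 \<in> \<rat>" "t1 < s1" "s1 < min (t1 + d1) t"
      using Rats_dense_in_real[of t1 "min (t1 + d1) t"] d1 t by auto
    obtain s where s: "s \<in> \<rat>" "t < s" "s < min (t + d) t2"
      using Rats_dense_in_real[of t "min (t + d) t2"] d t by auto
    have "\<exists>s2\<in>insert T \<rat>. t2 \<le> s2 \<and> s2 \<le> T \<and> s2 - s1 \<le> \<delta> \<and> norm (f s2 - f t2) \<le> e/3"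
    proof (cases "t2 = T")
      case True
      then show ?thesis using t s1 e by (intro bexI[of _ T]) auto
    next
      case False
      obtain d2 where d2: "0 < d2" "\<forall>s. s \<le> T \<and> t2 < s \<and> s < t2 + d2 \<longrightarrow> norm (f s - f t2) \<le> e/3"
        using right[of t2] t by auto
      obtain s2 where s2: "s2 \<in> \<rat>" "t2 < s2" "s2 < min (min (t2 + d2) T) (t2 + (s1 - t1))"
        using Rats_dense_in_real[of t2 "min (min (t2 + d2) T) (t2 + (s1 - t1))"] d2 t s1 False by auto
      then show ?thesis using d2(2)[rule_format, of s2] t by (intro bexI[of _ s2]) auto
    qed
    then obtain s2 where s2: "s2 \<in> insert T \<rat>" "t2 \<le> s2" "s2 \<le> T" "s2 - s1 \<le> \<delta>" "norm (f s2 - f t2) \<le> e/3"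
      by blast
    have "(s1, s, s2) \<in> ?D"
      using s1 s s2 t by (auto simp: osc_triples_def)
    moreover have "norm (f s1 - f t1) \<le> e/3" "norm (f s - f t) \<le> e/3"
      using d1(2)[rule_format, of s1] d(2)[rule_format, of s] s1 s t by auto
    then have "seg_dist (f t1) (f t) (f t2) \<le> ?G (s1, s, s2) + e"
      using seg_dist_perturb[of "f t1" "f t" "f t2" "f s1" "f s" "f s2"] s2(5)
      by (simp add: norm_minus_commute)
    ultimately show ?thesis by blast
  qed
  have "\<exists>p\<in>?D. seg_dist (f 0) (f (min T \<delta> / 2)) (f (min T \<delta>)) \<le> ?G p + 1"
    using T \<delta> by (intro approx) auto
  then have ne: "?D \<noteq> {}" by (rule bexE) (rule notI, simp only: empty_iff)
  show ?thesis
  proof (rule antisym)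
    show "osc_M1 T f \<delta> \<le> (SUP p\<in>?D. ?G p)"
    proof (rule osc_M1_leI[OF T \<delta>], rule field_le_epsilon)
      fix t1 t t2 e :: real
      assume "0 \<le> t1" "t1 < t" "t < t2" "t2 \<le> T" "t2 - t1 \<le> \<delta>" "0 < e"
      then obtain p where p: "p \<in> ?D" "seg_dist (f t1) (f t) (f t2) \<le> ?G p + e"
        using approx by blast
      have "?G p \<le> (SUP p\<in>?D. ?G p)" by (rule cSUP_upper[OF p(1) bddD])
      then show "seg_dist (f t1) (f t) (f t2) \<le> (SUP p\<in>?D. ?G p) + e" using p(2) by linarith
    qed
    show "(SUP p\<in>?D. ?G p) \<le> osc_M1 T f \<delta>"
      unfolding osc_M1_altdef by (intro cSUP_subset_mono ne bdd) auto
  qed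
qed

lemma processD:
  assumes "stoch_cont_cadlag_process M T X"
  shows "t \<in> {0..T} \<Longrightarrow> X t \<in> borel_measurable M" "stoch_continuous_on M T X"
    "\<omega> \<in> space M \<Longrightarrow> cadlag_on T (\<lambda>t. X t \<omega>)"
  using assms by (auto simp: stoch_cont_cadlag_process_def)

lemma measurable_osc_M1:
  fixes X :: "real \<Rightarrow> 'w \<Rightarrow> 'v::{real_normed_vector, second_countable_topology}"
  assumes X: "stoch_cont_cadlag_process M T X" and T: "0 < T" and \<delta>: "0 < \<delta>"
  shows "(\<lambda>\<omega>. osc_M1 T (\<lambda>t. X t \<omega>) \<delta>) \<in> borel_measurable M"
proof -
  let ?D = "osc_triples T \<delta> \<inter> (insert T \<rat>) \<times> (insert T \<rat>) \<times> (insert T \<rat>)"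
  have "countable ?D"
    by (intro countable_Int2 countable_SIGMA countable_insert countable_rat)
  then have "(\<lambda>\<omega>. SUP p\<in>?D. (case p of (t1, t, t2) \<Rightarrow> seg_dist (X t1 \<omega>) (X t \<omega>) (X t2 \<omega>))) \<in> borel_measurable M"
  proof (rule borel_measurable_cSUP)
    fix p assume "p \<in> ?D"
    then show "(\<lambda>\<omega>. case p of (t1, t, t2) \<Rightarrow> seg_dist (X t1 \<omega>) (X t \<omega>) (X t2 \<omega>)) \<in> borel_measurable M"
      by (cases p) (auto simp: osc_triples_def intro!: measurable_seg_dist processD(1)[OF X])
  next
    fix \<omega> assume "\<omega> \<in> space M"
    then have "bdd_above ((\<lambda>(t1, t, t2). seg_dist (X t1 \<omega>) (X t \<omega>) (X t2 \<omega>)) ` osc_triples T \<delta>)"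
      using osc_M1_bdd[OF processD(3)[OF X]] T by simp
    then show "bdd_above ((\<lambda>p. case p of (t1, t, t2) \<Rightarrow> seg_dist (X t1 \<omega>) (X t \<omega>) (X t2 \<omega>)) ` ?D)"
      by (rule bdd_above_mono[OF _ image_mono[OF Int_lower1]])
  qed
  also have "?this \<longleftrightarrow> ?thesis"
    by (intro measurable_cong osc_M1_countable[symmetric] processD(3)[OF X] T \<delta>)
  finally show ?thesis .
qed

lemma polygon_cong: "(\<And>i. i \<le> n \<Longrightarrow> x i = y i) \<Longrightarrow> polygon T n x = polygon T n y"
  unfolding polygon_def interp_def by (intro ext arg_cong2[of _ _ _ _ "(+)"] sum.cong) auto

text \<open>
  By the triangle inequality the distance of two polygons is Lipschitz in their vertices. Sequences of
  vertices carry the product topology, whose Borel sets are generated by the coordinates.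
\<close>

lemma continuous_dist_M1_polygon:
  fixes T :: real
  assumes T: "0 < T" and n: "0 < n"
  shows "continuous_on UNIV (\<lambda>z :: nat \<Rightarrow> 'v::real_normed_vector \<times> 'v.
           dist_M1 T (polygon T n (\<lambda>i. fst (z i))) (polygon T n (\<lambda>i. snd (z i))))"
proof -
  define p where "p x = polygon T n x" for x :: "nat \<Rightarrow> 'v"
  define F where "F z = dist_M1 T (p (\<lambda>i. fst (z i))) (p (\<lambda>i. snd (z i)))" for z
  define E where "E z w = (\<Sum>i\<le>n. norm (w i - z i))" for z w :: "nat \<Rightarrow> 'v \<times> 'v"
  have ne: "param_reps T (p x) \<noteq> {}" for x
    unfolding p_def by (rule param_reps_polygon_nonempty[OF T])
  have lip: "dist_M1 T (p (\<lambda>i. g (z i))) (p (\<lambda>i. g (w i))) \<le> E z w"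
    if g: "\<And>a b. norm (g a - g b) \<le> norm (b - a)" for g :: "'v \<times> 'v \<Rightarrow> 'v" and z w
    unfolding p_def
  proof (rule dist_M1_polygon_le[OF T n])
    fix i assume "i \<le> n"
    then have "norm (w i - z i) \<le> E z w"
      unfolding E_def by (intro member_le_sum) auto
    then show "norm (g (z i) - g (w i)) \<le> E z w" using g[of "z i" "w i"] by simp
  qed
  have fst: "norm (fst a - fst b) \<le> norm (b - a)" and snd: "norm (snd a - snd b) \<le> norm (b - a)"
    for a b :: "'v \<times> 'v"
    using dist_fst_le[of a b] dist_snd_le[of a b] by (simp_all add: dist_norm norm_minus_commute[of b a])
  have le: "F z \<le> F w + 2 * E z w" for z w
  proof -
    have "F z \<le> dist_M1 T (p (\<lambda>i. fst (z i))) (p (\<lambda>i. fst (w i))) + dist_M1 T (p (\<lambda>i. fst (w i))) (p (\<lambda>i. snd (z i)))"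
      "dist_M1 T (p (\<lambda>i. fst (w i))) (p (\<lambda>i. snd (z i))) \<le> F w + dist_M1 T (p (\<lambda>i. snd (w i))) (p (\<lambda>i. snd (z i)))"
      unfolding F_def by (intro dist_M1_triangle T ne)+
    then show ?thesis
      using lip[OF fst, of z w] lip[OF snd, of z w]
        dist_M1_commute[of T "p (\<lambda>i. snd (w i))" "p (\<lambda>i. snd (z i))"] by linarith
  qed
  have "(F \<longlongrightarrow> F z) (at z)" for z
  proof -
    have "continuous_on UNIV (\<lambda>w. 2 * E z w)"
      unfolding E_def by (intro continuous_intros continuous_on_product_coordinates)
    then have "((\<lambda>w. 2 * E z w) \<longlongrightarrow> 2 * E z z) (at z)"
      by (simp add: continuous_on_def)
    then have "((\<lambda>w. 2 * E z w) \<longlongrightarrow> 0) (at z)" by (simp add: E_def)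
    moreover have "norm (F w - F z) \<le> 2 * E z w" for w
    proof -
      have "E w z = E z w" by (simp add: E_def norm_minus_commute)
      then show ?thesis using le[of z w] le[of w z] by (simp add: abs_le_iff)
    qed
    ultimately have "((\<lambda>w. F w - F z) \<longlongrightarrow> 0) (at z)"
      by - (rule Lim_null_comparison[OF always_eventually], auto)
    then show ?thesis by (rule LIM_zero_cancel)
  qed
  then have "continuous_on UNIV F" by (simp add: continuous_on_def)
  then show ?thesis by (simp add: F_def[abs_def] p_def)
qed

lemma measurable_dist_M1:
  fixes X Y :: "real \<Rightarrow> 'w \<Rightarrow> 'v::{real_normed_vector, second_countable_topology}"
  assumes X: "stoch_cont_cadlag_process M T X" and Y: "stoch_cont_cadlag_process M T Y" and T: "0 < T"
  shows "(\<lambda>\<omega>. dist_M1 T (\<lambda>t. X t \<omega>) (\<lambda>t. Y t \<omega>)) \<in> borel_measurable M"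
proof (rule borel_measurable_LIMSEQ_real)
  fix \<omega> assume "\<omega> \<in> space M"
  then show "(\<lambda>n. dist_M1 T (polygon T (Suc n) (\<lambda>i. X (grid T (Suc n) i) \<omega>))
                        (polygon T (Suc n) (\<lambda>i. Y (grid T (Suc n) i) \<omega>)))
         \<longlonglongrightarrow> dist_M1 T (\<lambda>t. X t \<omega>) (\<lambda>t. Y t \<omega>)"
    by (intro dist_M1_polygon_tendsto processD(3)[OF X] processD(3)[OF Y] T)
next
  fix n
  \<comment> \<open>Coordinates beyond the last vertex are filled with the last one, so that all of them are measurable.\<close>
  define z where "z \<omega> i = (X (grid T (Suc n) (min i (Suc n))) \<omega>, Y (grid T (Suc n) (min i (Suc n))) \<omega>)" for \<omega> i
  have "z \<in> borel_measurable M"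
  proof (rule measurable_coordinatewise_then_product)
    fix i
    have "grid T (Suc n) (min i (Suc n)) \<in> {0..T}" by (rule grid_range[OF T]) simp
    then show "(\<lambda>\<omega>. z \<omega> i) \<in> borel_measurable M"
      unfolding z_def by (intro borel_measurable_Pair processD(1)[OF X] processD(1)[OF Y])
  qed
  then have "(\<lambda>\<omega>. dist_M1 T (polygon T (Suc n) (\<lambda>i. fst (z \<omega> i))) (polygon T (Suc n) (\<lambda>i. snd (z \<omega> i)))) \<in> borel_measurable M"
    using measurable_compose[OF _ borel_measurable_continuous_onI[OF continuous_dist_M1_polygon[OF T, of "Suc n"]]]
    by simp
  moreover have "polygon T (Suc n) (\<lambda>i. fst (z \<omega> i)) = polygon T (Suc n) (\<lambda>i. X (grid T (Suc n) i) \<omega>)"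
    "polygon T (Suc n) (\<lambda>i. snd (z \<omega> i)) = polygon T (Suc n) (\<lambda>i. Y (grid T (Suc n) i) \<omega>)" for \<omega>
    by (intro polygon_cong; simp add: z_def min_def)+
  ultimately show "(\<lambda>\<omega>. dist_M1 T (polygon T (Suc n) (\<lambda>i. X (grid T (Suc n) i) \<omega>))
                        (polygon T (Suc n) (\<lambda>i. Y (grid T (Suc n) i) \<omega>))) \<in> borel_measurable M"
    by simp
qed

section \<open>Convergence in probability\<close>

lemma eventually_measure_small:
  assumes "converges_in_prob M d Y Z F" "0 < \<epsilon>" "0 < \<kappa>"
  shows "\<forall>\<^sub>F i in F. measure M {\<omega> \<in> space M. d (Y i \<omega>) (Z \<omega>) \<ge> \<epsilon>} < \<kappa>"
proof -
  have "((\<lambda>i. measure M {\<omega> \<in> space M. d (Y i \<omega>) (Z \<omega>) \<ge> \<epsilon>}) \<longlongrightarrow> 0) F"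
    using assms by (simp add: converges_in_prob_def)
  then show ?thesis using assms(3) by (rule order_tendstoD)
qed

lemma converges_in_probI:
  assumes "\<And>\<epsilon> \<kappa>. 0 < \<epsilon> \<Longrightarrow> 0 < \<kappa> \<Longrightarrow>
    \<forall>\<^sub>F i in F. measure M {\<omega> \<in> space M. d (Y i \<omega>) (Z \<omega>) \<ge> \<epsilon>} < \<kappa>"
  shows "converges_in_prob M d Y Z F"
  unfolding converges_in_prob_def
proof (intro allI impI order_tendstoI)
  fix \<epsilon> a :: real assume "0 < \<epsilon>" "a < 0"
  then show "\<forall>\<^sub>F i in F. a < measure M {\<omega> \<in> space M. d (Y i \<omega>) (Z \<omega>) \<ge> \<epsilon>}"
    by (intro always_eventually) (auto intro: order_less_le_trans[OF _ measure_nonneg])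
qed (use assms in auto)

text \<open>
  The events decrease with \<open>\<delta>\<close>, and their intersection is empty because
  \<open>M(f;\<delta>) \<rightarrow> 0\<close> along each path.
\<close>

lemma (in prob_space) osc_M1_small_in_prob:
  fixes X :: "real \<Rightarrow> 'a \<Rightarrow> 'v::{real_normed_vector, second_countable_topology}"
  assumes X: "stoch_cont_cadlag_process M T X" and T: "0 < T" and \<epsilon>: "0 < \<epsilon>" and \<kappa>: "0 < \<kappa>"
  obtains \<delta> where "0 < \<delta>" "measure M {\<omega> \<in> space M. osc_M1 T (\<lambda>t. X t \<omega>) \<delta> \<ge> \<epsilon>} < \<kappa>"
proof -
  define d where "d n = inverse (real (Suc n))" for n
  have d: "0 < d n" for n by (simp add: d_def)
  define A where "A n = {\<omega> \<in> space M. osc_M1 T (\<lambda>t. X t \<omega>) (d n) \<ge> \<epsilon>}" for n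
  have "range A \<subseteq> sets M"
    using measurable_osc_M1[OF X T d] by (auto simp: A_def)
  moreover have "decseq A"
  proof (rule decseq_SucI, safe)
    fix n \<omega> assume "\<omega> \<in> A (Suc n)"
    moreover have "osc_M1 T (\<lambda>t. X t \<omega>) (d (Suc n)) \<le> osc_M1 T (\<lambda>t. X t \<omega>) (d n)" if "\<omega> \<in> space M"
      using that by (intro osc_M1_mono processD(3)[OF X] T d) (auto simp: d_def intro!: le_imp_inverse_le)
    ultimately show "\<omega> \<in> A n" by (auto simp: A_def)
  qed
  ultimately have "(\<lambda>n. measure M (A n)) \<longlonglongrightarrow> measure M (\<Inter>n. A n)"
    by (rule finite_Lim_measure_decseq)
  moreover have "(\<Inter>n. A n) = {}"
  proof -
    have "\<exists>n. \<omega> \<notin> A n" if w: "\<omega> \<in> space M" for \<omega>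
    proof -
      have "filterlim d (at_right 0) sequentially"
        unfolding d_def using LIMSEQ_inverse_real_of_nat
        by (intro tendsto_imp_filterlim_at_right always_eventually) auto
      then have "(\<lambda>n. osc_M1 T (\<lambda>t. X t \<omega>) (d n)) \<longlonglongrightarrow> 0"
        by (rule filterlim_compose[OF osc_M1_tendsto_0[OF processD(3)[OF X w] T]])
      then have "\<forall>\<^sub>F n in sequentially. osc_M1 T (\<lambda>t. X t \<omega>) (d n) < \<epsilon>"
        using \<epsilon> by (rule order_tendstoD)
      then obtain n where "osc_M1 T (\<lambda>t. X t \<omega>) (d n) < \<epsilon>"
        by (auto simp: eventually_sequentially)
      then show ?thesis by (intro exI[of _ n]) (auto simp: A_def)
    qed
    then show ?thesis by (auto simp: A_def)
  qed
  ultimately have "(\<lambda>n. measure M (A n)) \<longlonglongrightarrow> 0" by simp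
  then have "\<forall>\<^sub>F n in sequentially. measure M (A n) < \<kappa>"
    using \<kappa> by (rule order_tendstoD)
  then obtain n where "measure M (A n) < \<kappa>" by (auto simp: eventually_sequentially)
  then show ?thesis using that[OF d] by (simp add: A_def)
qed

lemma (in prob_space) measure_le_union:
  assumes "A \<subseteq> B \<union> C" "B \<in> sets M" "C \<in> sets M"
  shows "measure M A \<le> measure M B + measure M C"
  using finite_measure_mono[OF assms(1)] measure_Un_le[OF assms(2,3)] assms by auto

text \<open>
  Stochastic continuity of \<open>X\<close> at \<open>t\<close> is what keeps jumps away from
  \<open>t\<close>: it makes \<open>X t1\<close> and \<open>X t2\<close> close to \<open>X
  t\<close>. The budget is \<open>\<epsilon>/4\<close> for \<open>\<eta>\<close>, for \<open>9
  M(X;\<delta>)\<close> and for the two increments.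
\<close>

lemma (in prob_space) marginals_converge_if_dist_M1:
  fixes X :: "real \<Rightarrow> 'a \<Rightarrow> 'v::{real_normed_vector, second_countable_topology}"
  assumes T: "0 < T" and X: "stoch_cont_cadlag_process M T X"
    and Xn: "\<And>n. stoch_cont_cadlag_process M T (Xn n)"
    and conv: "converges_in_prob M (dist_M1 T) (\<lambda>n \<omega> t. Xn n t \<omega>) (\<lambda>\<omega> t. X t \<omega>) sequentially"
    and t: "t \<in> {0..T}"
  shows "converges_in_prob M dist (\<lambda>n. Xn n t) (X t) sequentially"
proof (rule converges_in_probI)
  fix \<epsilon> \<kappa> :: real assume \<epsilon>: "0 < \<epsilon>" and \<kappa>: "0 < \<kappa>"
  obtain \<delta> where \<delta>: "0 < \<delta>" and osc: "measure M {\<omega> \<in> space M. osc_M1 T (\<lambda>t. X t \<omega>) \<delta> \<ge> \<epsilon>/36} < \<kappa>/4"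
    using osc_M1_small_in_prob[OF X T, of "\<epsilon>/36" "\<kappa>/4"] \<epsilon> \<kappa> by auto
  have "\<forall>\<^sub>F s in at t within {0..T}. measure M {\<omega> \<in> space M. dist (X s \<omega>) (X t \<omega>) \<ge> \<epsilon>/4} < \<kappa>/4"
    using processD(2)[OF X] t \<epsilon> \<kappa> unfolding stoch_continuous_on_def
    by (intro eventually_measure_small[where Y = X]) auto
  then obtain d where d: "0 < d" and
    sc: "\<And>s. s \<in> {0..T} \<Longrightarrow> s \<noteq> t \<Longrightarrow> dist s t < d \<Longrightarrow> measure M {\<omega> \<in> space M. dist (X s \<omega>) (X t \<omega>) \<ge> \<epsilon>/4} < \<kappa>/4"
    unfolding eventually_at by blast
  have close: "measure M {\<omega> \<in> space M. dist (X s \<omega>) (X t \<omega>) \<ge> \<epsilon>/4} < \<kappa>/4" if "s \<in> {0..T}" "dist s t < d" for s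
    using sc[OF that(1) _ that(2)] \<epsilon> \<kappa> by (cases "s = t") auto
  define q where "q = min (\<delta>/3) (d/2)"
  define \<eta> where "\<eta> = min q (\<epsilon>/4)"
  have q: "0 < q" "2 * q < \<delta>" "q < d" using d \<delta> by (auto simp: q_def)
  have \<eta>: "0 < \<eta>" "\<eta> \<le> q" "\<eta> \<le> \<epsilon>/4" using q \<epsilon> by (auto simp: \<eta>_def)
  define t1 where "t1 = max 0 (t - q)"
  define t2 where "t2 = min T (t + q)"
  have t12: "0 \<le> t1" "t1 \<le> t" "t \<le> t2" "t2 \<le> T" "t2 - t1 < \<delta>" "t1 = 0 \<or> \<eta> \<le> t - t1" "t2 = T \<or> \<eta> \<le> t2 - t"
    using t q \<eta> by (auto simp: t1_def t2_def)
  have t12_d: "t1 \<in> {0..T}" "t2 \<in> {0..T}" "dist t1 t < d" "dist t2 t < d"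
    using t q by (auto simp: t1_def t2_def dist_real_def)
  have "\<forall>\<^sub>F n in sequentially. measure M {\<omega> \<in> space M. dist_M1 T (\<lambda>t. Xn n t \<omega>) (\<lambda>t. X t \<omega>) \<ge> \<eta>} < \<kappa>/4"
    using eventually_measure_small[OF conv \<eta>(1), of "\<kappa>/4"] \<kappa> by simp
  then show "\<forall>\<^sub>F n in sequentially. measure M {\<omega> \<in> space M. dist (Xn n t \<omega>) (X t \<omega>) \<ge> \<epsilon>} < \<kappa>"
  proof eventually_elim
    fix n assume n: "measure M {\<omega> \<in> space M. dist_M1 T (\<lambda>t. Xn n t \<omega>) (\<lambda>t. X t \<omega>) \<ge> \<eta>} < \<kappa>/4"
    let ?A = "{\<omega> \<in> space M. dist_M1 T (\<lambda>t. Xn n t \<omega>) (\<lambda>t. X t \<omega>) \<ge> \<eta>}"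
    let ?B = "{\<omega> \<in> space M. osc_M1 T (\<lambda>t. X t \<omega>) \<delta> \<ge> \<epsilon>/36}"
    let ?C = "\<lambda>s. {\<omega> \<in> space M. dist (X s \<omega>) (X t \<omega>) \<ge> \<epsilon>/4}"
    have A: "?A \<in> sets M" using measurable_dist_M1[OF Xn X T] by auto
    have B: "?B \<in> sets M" using measurable_osc_M1[OF X T \<delta>] by auto
    have C: "?C s \<in> sets M" if "s \<in> {0..T}" for s
      using processD(1)[OF X that] processD(1)[OF X t] by auto
    have "{\<omega> \<in> space M. dist (Xn n t \<omega>) (X t \<omega>) \<ge> \<epsilon>} \<subseteq> (?A \<union> ?B) \<union> (?C t1 \<union> ?C t2)"
    proof (rule subsetI, rule ccontr)
      fix \<omega> assume w: "\<omega> \<in> {\<omega> \<in> space M. dist (Xn n t \<omega>) (X t \<omega>) \<ge> \<epsilon>}"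
        and no: "\<omega> \<notin> (?A \<union> ?B) \<union> (?C t1 \<union> ?C t2)"
      have sp: "\<omega> \<in> space M" using w by simp
      have "norm (Xn n t \<omega> - X t \<omega>) \<le> \<eta> + 9 * osc_M1 T (\<lambda>t. X t \<omega>) \<delta> + \<epsilon>/4"
        using no sp
        by (intro norm_diff_le_if_dist_M1_less[OF processD(3)[OF X sp] processD(3)[OF Xn sp] T t12(1-5) \<delta> _ t12(6,7)])
          (auto simp: dist_norm)
      then show False using w no sp \<eta>(3) \<epsilon> by (auto simp: dist_norm)
    qed
    then have "measure M {\<omega> \<in> space M. dist (Xn n t \<omega>) (X t \<omega>) \<ge> \<epsilon>}
        \<le> measure M (?A \<union> ?B) + measure M (?C t1 \<union> ?C t2)"
      using A B C[OF t12_d(1)] C[OF t12_d(2)] by (intro measure_le_union sets.Un)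
    also have "\<dots> \<le> (measure M ?A + measure M ?B) + (measure M (?C t1) + measure M (?C t2))"
      by (intro add_mono measure_Un_le A B C t12_d)
    also have "\<dots> < \<kappa>"
      using n osc close[OF t12_d(1,3)] close[OF t12_d(2,4)] by linarith
    finally show "measure M {\<omega> \<in> space M. dist (Xn n t \<omega>) (X t \<omega>) \<ge> \<epsilon>} < \<kappa>" .
  qed
qed

text \<open>
  The budget \<open>\<epsilon>\<close> is shared by \<open>3\<eta> \<le> \<epsilon>/2\<close> and
  \<open>9 M(X;\<delta>1) < \<epsilon>/4\<close>.
\<close>

lemma (in prob_space) osc_M1_limsup_if_dist_M1:
  fixes X :: "real \<Rightarrow> 'a \<Rightarrow> 'v::{real_normed_vector, second_countable_topology}"
  assumes T: "0 < T" and X: "stoch_cont_cadlag_process M T X"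
    and Xn: "\<And>n. stoch_cont_cadlag_process M T (Xn n)"
    and conv: "converges_in_prob M (dist_M1 T) (\<lambda>n \<omega> t. Xn n t \<omega>) (\<lambda>\<omega> t. X t \<omega>) sequentially"
    and \<epsilon>: "0 < \<epsilon>"
  shows "((\<lambda>\<delta>. limsup (\<lambda>n. ereal (measure M
           {\<omega> \<in> space M. osc_M1 T (\<lambda>t. Xn n t \<omega>) \<delta> \<ge> \<epsilon>}))) \<longlongrightarrow> 0) (at_right 0)"
proof (rule order_tendstoI)
  fix a :: ereal assume a: "a < 0"
  have "0 \<le> limsup (\<lambda>n. ereal (measure M {\<omega> \<in> space M. osc_M1 T (\<lambda>t. Xn n t \<omega>) \<delta> \<ge> \<epsilon>}))" for \<delta>
    by (rule le_Limsup) (auto intro!: always_eventually)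
  then show "\<forall>\<^sub>F \<delta> in at_right 0. a < limsup (\<lambda>n. ereal (measure M {\<omega> \<in> space M. osc_M1 T (\<lambda>t. Xn n t \<omega>) \<delta> \<ge> \<epsilon>}))"
    using a by (intro always_eventually allI) (rule order_less_le_trans)
next
  fix a :: ereal assume "0 < a"
  then obtain \<kappa> where \<kappa>: "0 < \<kappa>" "ereal \<kappa> < a"
    by (metis ereal_dense2 ereal_less(2) zero_ereal_def)
  obtain \<delta>1 where \<delta>1: "0 < \<delta>1" and osc: "measure M {\<omega> \<in> space M. osc_M1 T (\<lambda>t. X t \<omega>) \<delta>1 \<ge> \<epsilon>/36} < \<kappa>/2"
    using osc_M1_small_in_prob[OF X T, of "\<epsilon>/36" "\<kappa>/2"] \<epsilon> \<kappa> by auto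
  define \<eta> where "\<eta> = min (\<delta>1/4) (\<epsilon>/6)"
  have \<eta>: "0 < \<eta>" "2 * \<eta> \<le> \<delta>1/2" "3 * \<eta> \<le> \<epsilon>/2" using \<delta>1 \<epsilon> by (auto simp: \<eta>_def)
  have "limsup (\<lambda>n. ereal (measure M {\<omega> \<in> space M. osc_M1 T (\<lambda>t. Xn n t \<omega>) \<delta> \<ge> \<epsilon>})) < a"
    if \<delta>: "0 < \<delta>" "\<delta> < \<delta>1/2" for \<delta>
  proof -
    have "\<forall>\<^sub>F n in sequentially. measure M {\<omega> \<in> space M. dist_M1 T (\<lambda>t. Xn n t \<omega>) (\<lambda>t. X t \<omega>) \<ge> \<eta>} < \<kappa>/2"
      using eventually_measure_small[OF conv \<eta>(1), of "\<kappa>/2"] \<kappa> by simp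
    then have "\<forall>\<^sub>F n in sequentially. ereal (measure M {\<omega> \<in> space M. osc_M1 T (\<lambda>t. Xn n t \<omega>) \<delta> \<ge> \<epsilon>}) \<le> ereal \<kappa>"
    proof eventually_elim
      fix n assume n: "measure M {\<omega> \<in> space M. dist_M1 T (\<lambda>t. Xn n t \<omega>) (\<lambda>t. X t \<omega>) \<ge> \<eta>} < \<kappa>/2"
      let ?A = "{\<omega> \<in> space M. dist_M1 T (\<lambda>t. Xn n t \<omega>) (\<lambda>t. X t \<omega>) \<ge> \<eta>}"
      let ?B = "{\<omega> \<in> space M. osc_M1 T (\<lambda>t. X t \<omega>) \<delta>1 \<ge> \<epsilon>/36}"
      have A: "?A \<in> sets M" using measurable_dist_M1[OF Xn X T] by auto
      have B: "?B \<in> sets M" using measurable_osc_M1[OF X T \<delta>1] by auto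
      have "{\<omega> \<in> space M. osc_M1 T (\<lambda>t. Xn n t \<omega>) \<delta> \<ge> \<epsilon>} \<subseteq> ?A \<union> ?B"
      proof (rule subsetI, rule ccontr)
        fix \<omega> assume w: "\<omega> \<in> {\<omega> \<in> space M. osc_M1 T (\<lambda>t. Xn n t \<omega>) \<delta> \<ge> \<epsilon>}" and no: "\<omega> \<notin> ?A \<union> ?B"
        have sp: "\<omega> \<in> space M" using w by simp
        have "osc_M1 T (\<lambda>t. Xn n t \<omega>) \<delta> \<le> 3 * \<eta> + 9 * osc_M1 T (\<lambda>t. X t \<omega>) \<delta>1"
          using no sp \<delta> \<eta>
          by (intro osc_M1_le_if_dist_M1_less[OF processD(3)[OF X sp] processD(3)[OF Xn sp] T \<delta>(1)]) auto
        then show False using w no sp \<eta>(3) \<epsilon> by auto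
      qed
      then have "measure M {\<omega> \<in> space M. osc_M1 T (\<lambda>t. Xn n t \<omega>) \<delta> \<ge> \<epsilon>} \<le> measure M ?A + measure M ?B"
        using A B by (rule measure_le_union)
      then show "ereal (measure M {\<omega> \<in> space M. osc_M1 T (\<lambda>t. Xn n t \<omega>) \<delta> \<ge> \<epsilon>}) \<le> ereal \<kappa>"
        using n osc by simp
    qed
    then have "limsup (\<lambda>n. ereal (measure M {\<omega> \<in> space M. osc_M1 T (\<lambda>t. Xn n t \<omega>) \<delta> \<ge> \<epsilon>})) \<le> ereal \<kappa>"
      by (rule Limsup_bounded)
    then show ?thesis using \<kappa>(2) by (rule order_le_less_trans)
  qed
  then show "\<forall>\<^sub>F \<delta> in at_right 0. limsup (\<lambda>n. ereal (measure M {\<omega> \<in> space M. osc_M1 T (\<lambda>t. Xn n t \<omega>) \<delta> \<ge> \<epsilon>})) < a"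
    using \<delta>1 by (auto simp: eventually_at_right[of 0 1] intro!: exI[of _ "\<delta>1/2"])
qed

text \<open>
  The bound of \<open>dist_M1_le_grid\<close> is made smaller than \<open>\<epsilon>\<close> by giving
  \<open>\<epsilon>/4\<close> to the mesh and to each of the two oscillations (hence
  \<open>\<epsilon>/108\<close> before the factor \<open>27\<close>), and
  \<open>\<epsilon>/8\<close> to the grid values.
\<close>

lemma (in prob_space) dist_M1_converges_if_marginals:
  fixes X :: "real \<Rightarrow> 'a \<Rightarrow> 'v::{real_normed_vector, second_countable_topology}"
  assumes T: "0 < T" and X: "stoch_cont_cadlag_process M T X"
    and Xn: "\<And>n. stoch_cont_cadlag_process M T (Xn n)"
    and marg: "\<And>t. t \<in> {0..T} \<Longrightarrow> converges_in_prob M dist (\<lambda>n. Xn n t) (X t) sequentially"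
    and osc: "\<And>\<epsilon>. 0 < \<epsilon> \<Longrightarrow> ((\<lambda>\<delta>. limsup (\<lambda>n. ereal (measure M
           {\<omega> \<in> space M. osc_M1 T (\<lambda>t. Xn n t \<omega>) \<delta> \<ge> \<epsilon>}))) \<longlongrightarrow> 0) (at_right 0)"
  shows "converges_in_prob M (dist_M1 T) (\<lambda>n \<omega> t. Xn n t \<omega>) (\<lambda>\<omega> t. X t \<omega>) sequentially"
proof (rule converges_in_probI)
  fix \<epsilon> \<kappa> :: real assume \<epsilon>: "0 < \<epsilon>" and \<kappa>: "0 < \<kappa>"
  define c where "c = \<epsilon>/108"
  have c: "0 < c" using \<epsilon> by (simp add: c_def)
  obtain \<delta>1 where \<delta>1: "0 < \<delta>1" and oX1: "measure M {\<omega> \<in> space M. osc_M1 T (\<lambda>t. X t \<omega>) \<delta>1 \<ge> c} < \<kappa>/3"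
    using osc_M1_small_in_prob[OF X T c, of "\<kappa>/3"] \<kappa> by auto
  have "0 < ereal (\<kappa>/3)" using \<kappa> by simp
  with osc[OF c] have "\<forall>\<^sub>F \<delta> in at_right 0. limsup (\<lambda>n. ereal (measure M {\<omega> \<in> space M. osc_M1 T (\<lambda>t. Xn n t \<omega>) \<delta> \<ge> c})) < ereal (\<kappa>/3)"
    by (rule order_tendstoD(2))
  moreover have "\<forall>\<^sub>F \<delta> in at_right 0. 0 < \<delta> \<and> \<delta> < \<delta>1"
    using \<delta>1 by (auto simp: eventually_at_right[of 0 1] intro!: exI[of _ \<delta>1])
  ultimately have "\<forall>\<^sub>F \<delta> in at_right 0. limsup (\<lambda>n. ereal (measure M {\<omega> \<in> space M. osc_M1 T (\<lambda>t. Xn n t \<omega>) \<delta> \<ge> c})) < ereal (\<kappa>/3)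
      \<and> 0 < \<delta> \<and> \<delta> < \<delta>1"
    by (rule eventually_conj)
  then obtain \<delta> where \<delta>: "0 < \<delta>" "\<delta> < \<delta>1"
    and ls: "limsup (\<lambda>n. ereal (measure M {\<omega> \<in> space M. osc_M1 T (\<lambda>t. Xn n t \<omega>) \<delta> \<ge> c})) < ereal (\<kappa>/3)"
    using eventually_happens'[of "at_right (0::real)"] trivial_limit_at_right_real by blast
  have ev1: "\<forall>\<^sub>F n in sequentially. measure M {\<omega> \<in> space M. osc_M1 T (\<lambda>t. Xn n t \<omega>) \<delta> \<ge> c} < \<kappa>/3"
    using Limsup_lessD[OF ls] by simp
  define h where "h = min \<delta> (\<epsilon>/8)"
  have h: "0 < h" "h \<le> \<delta>" "h \<le> \<epsilon>/8" using \<delta> \<epsilon> by (auto simp: h_def)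
  obtain N where N': "T / h < real N" using reals_Archimedean2 by blast
  moreover have "0 < T / h" using T h by simp
  ultimately have "0 < real N" by linarith
  then have N: "0 < N" "T / real N < h"
    using N' h(1) by (auto simp: pos_divide_less_eq mult.commute)
  define C where "C n i = {\<omega> \<in> space M. dist (Xn n (grid T N i) \<omega>) (X (grid T N i) \<omega>) \<ge> \<epsilon>/8}" for n i
  have "(\<lambda>n. \<Sum>i\<le>N. measure M (C n i)) \<longlonglongrightarrow> (\<Sum>i\<le>N. 0)"
  proof (rule tendsto_sum)
    fix i assume "i \<in> {..N}"
    then show "(\<lambda>n. measure M (C n i)) \<longlonglongrightarrow> 0"
      using marg[OF grid_range[OF T, of i N], unfolded converges_in_prob_def, rule_format, of "\<epsilon>/8"] \<epsilon>
      unfolding C_def by simp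
  qed
  then have "(\<lambda>n. \<Sum>i\<le>N. measure M (C n i)) \<longlonglongrightarrow> 0" by simp
  moreover have "0 < \<kappa>/3" using \<kappa> by simp
  ultimately have ev2: "\<forall>\<^sub>F n in sequentially. (\<Sum>i\<le>N. measure M (C n i)) < \<kappa>/3"
    by (rule order_tendstoD(2))
  show "\<forall>\<^sub>F n in sequentially. measure M {\<omega> \<in> space M. dist_M1 T (\<lambda>t. Xn n t \<omega>) (\<lambda>t. X t \<omega>) \<ge> \<epsilon>} < \<kappa>"
    using ev1 ev2
  proof eventually_elim
    fix n assume n1: "measure M {\<omega> \<in> space M. osc_M1 T (\<lambda>t. Xn n t \<omega>) \<delta> \<ge> c} < \<kappa>/3"
      and n2: "(\<Sum>i\<le>N. measure M (C n i)) < \<kappa>/3"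
    let ?A = "{\<omega> \<in> space M. osc_M1 T (\<lambda>t. Xn n t \<omega>) \<delta> \<ge> c}"
    let ?B = "{\<omega> \<in> space M. osc_M1 T (\<lambda>t. X t \<omega>) \<delta>1 \<ge> c}"
    have A: "?A \<in> sets M" using measurable_osc_M1[OF Xn T \<delta>(1)] by auto
    have B: "?B \<in> sets M" using measurable_osc_M1[OF X T \<delta>1] by auto
    have C: "C n i \<in> sets M" if "i \<le> N" for i
      using processD(1)[OF X grid_range[OF T that]] processD(1)[OF Xn grid_range[OF T that]]
      unfolding C_def by auto
    have "{\<omega> \<in> space M. dist_M1 T (\<lambda>t. Xn n t \<omega>) (\<lambda>t. X t \<omega>) \<ge> \<epsilon>} \<subseteq> (?A \<union> ?B) \<union> (\<Union>i\<in>{..N}. C n i)"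
    proof (rule subsetI, rule ccontr)
      fix \<omega> assume w: "\<omega> \<in> {\<omega> \<in> space M. dist_M1 T (\<lambda>t. Xn n t \<omega>) (\<lambda>t. X t \<omega>) \<ge> \<epsilon>}"
        and no: "\<omega> \<notin> (?A \<union> ?B) \<union> (\<Union>i\<in>{..N}. C n i)"
      have sp: "\<omega> \<in> space M" using w by simp
      have "dist_M1 T (\<lambda>t. Xn n t \<omega>) (\<lambda>t. X t \<omega>)
          \<le> 2 * (T / real N) + 27 * osc_M1 T (\<lambda>t. Xn n t \<omega>) \<delta> + 27 * osc_M1 T (\<lambda>t. X t \<omega>) \<delta> + \<epsilon>/8"
        using no sp N h
        by (intro dist_M1_le_grid[OF processD(3)[OF Xn sp] processD(3)[OF X sp] T]) (force simp: C_def dist_norm)+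
      moreover have "osc_M1 T (\<lambda>t. X t \<omega>) \<delta> \<le> osc_M1 T (\<lambda>t. X t \<omega>) \<delta>1"
        using \<delta> by (intro osc_M1_mono[OF processD(3)[OF X sp] T]) auto
      moreover have "osc_M1 T (\<lambda>t. Xn n t \<omega>) \<delta> < \<epsilon>/108" "osc_M1 T (\<lambda>t. X t \<omega>) \<delta>1 < \<epsilon>/108"
        using no sp by (auto simp: c_def)
      ultimately show False using w N(2) h by auto
    qed
    then have "measure M {\<omega> \<in> space M. dist_M1 T (\<lambda>t. Xn n t \<omega>) (\<lambda>t. X t \<omega>) \<ge> \<epsilon>}
        \<le> measure M (?A \<union> ?B) + measure M (\<Union>i\<in>{..N}. C n i)"
      using A B C by (intro measure_le_union sets.Un sets.finite_UN) auto
    also have "\<dots> \<le> (measure M ?A + measure M ?B) + (\<Sum>i\<le>N. measure M (C n i))"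
      by (intro add_mono measure_Un_le measure_UNION_le A B) (auto intro: C)
    also have "\<dots> < \<kappa>" using n1 n2 oX1 by linarith
    finally show "measure M {\<omega> \<in> space M. dist_M1 T (\<lambda>t. Xn n t \<omega>) (\<lambda>t. X t \<omega>) \<ge> \<epsilon>} < \<kappa>" .
  qed
qed

theorem theorem3p2:
  fixes M :: "'w measure"
    and T :: real
    and X :: "real \<Rightarrow> 'w \<Rightarrow> 'v::{banach, second_countable_topology}"
    and Xn :: "nat \<Rightarrow> real \<Rightarrow> 'w \<Rightarrow> 'v"
  assumes "prob_space M"
    and "T > 0"
    and "stoch_cont_cadlag_process M T X"
    and "\<And>n. stoch_cont_cadlag_process M T (Xn n)"
  shows "converges_in_prob M (dist_M1 T) (\<lambda>n \<omega> t. Xn n t \<omega>) (\<lambda>\<omega> t. X t \<omega>) sequentially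
     \<longleftrightarrow>
       (\<forall>t\<in>{0..T}. converges_in_prob M dist (\<lambda>n. Xn n t) (X t) sequentially) \<and>
       (\<forall>\<epsilon>>0. ((\<lambda>\<delta>. limsup (\<lambda>n. ereal (measure M
                   {\<omega> \<in> space M. osc_M1 T (\<lambda>t. Xn n t \<omega>) \<delta> \<ge> \<epsilon>}))) \<longlongrightarrow> 0) (at_right 0))"
proof -
  interpret prob_space M by fact
  show ?thesis
    using marginals_converge_if_dist_M1[where Xn = Xn, OF assms(2-4)] osc_M1_limsup_if_dist_M1[where Xn = Xn, OF assms(2-4)]
      dist_M1_converges_if_marginals[where Xn = Xn, OF assms(2-4)] by blast
qed

end
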